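(* Let $V = (V_1, \dots, V_{n-1}) \in \operatorname{Fl}_n(\mathbb{R})$ be a complete flag in $\mathbb{R}^n$, and view each $V_k$ as a subspace of the space $\mathbb{R}[x]_{\le n-1}$ of real polynomials of degree at most $n-1$ via $(a_1,\dots,a_n)\leftrightarrow a_1+a_2x+\cdots+a_nx^{n-1}$. (i) The flag $V$ is totally nonnegative if and only if the Wronskian $\operatorname{Wr}(V_k)$ is nonzero on the interval $(0,\infty)$, for all $1 \le k \le n-1$. (ii) The flag $V$ is totally positive if and only if $\operatorname{Wr}(V_k)$ is nonzero on the interval $[0,\infty]$, for all $1 \le k \le n-1$. (Here, $\operatorname{Wr}(V_k)$ being nonzero at $\infty$ means that it has the expected degree $k(n-k)$.)
   Context: $\operatorname{Fl}_n(\mathbb{R})$ is the set of tuples $(V_1,\dots,V_{n-1})$ of subspaces of $\mathbb{R}^n$ with $\dim V_k = k$ and $V_1\subset\cdots\subset V_{n-1}$. For a $k$-dimensional subspace $V$ of $\mathbb{R}^n$, let $A$ be an $n\times k$ matrix whose columns form a basis of $V$. For a $k$-element subset $I\subseteq [n]=\{1,\dots,n\}$, the Plücker coordinate $\Delta_I(V)$ is the determinant of the submatrix of $A$ with rows $I$; the tuple $(\Delta_I(V))_I$ is well-defined up to simultaneous nonzero rescaling. $V$ is totally nonnegative (resp. totally positive) if, after some such rescaling by a nonzero real, all $\Delta_I(V)$ are nonnegative (resp. positive). A complete flag $(V_1,\dots,V_{n-1})$ is totally nonnegative (resp. totally positive) if each $V_k$, $1\le k\le n-1$, is. For polynomials $f_1,\dots,f_k$,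 $\operatorname{Wr}(f_1,\dots,f_k) := \det\big(\tfrac{d^{i-1}f_j}{dx^{i-1}}\big)_{1\le i,j\le k}$. For a $k$-dimensional subspace $V$ of $\mathbb{R}[x]_{\le n-1}$, $\operatorname{Wr}(V):=\operatorname{Wr}(f_1,\dots,f_k)$ for any basis $f_1,\dots,f_k$ of $V$; it is a nonzero polynomial of degree at most $k(n-k)$, well-defined up to a nonzero scalar. *)

theory Defs
  imports
    "HOL-Computational_Algebra.Polynomial"
    "Jordan_Normal_Form.Determinant"
    "Jordan_Normal_Form.DL_Submatrix"
    "Jordan_Normal_Form.VS_Connect"
begin

text \<open>
  Since the dimensions of the matrices below vary with \<open>k\<close>, the space \<open>\<real>\<^sup>n\<close> is rendered as the
  carrier-based vector space \<open>module_vec TYPE(real) n\<close>. Coordinates, rows and columns are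
  numbered from 0, so \<open>[n]\<close> becomes \<open>{..<n}\<close>.
\<close>

definition is_subspace :: "nat \<Rightarrow> real vec set \<Rightarrow> bool" where
  "is_subspace n W \<longleftrightarrow> VectorSpace.subspace class_ring W (module_vec TYPE(real) n)"

definition subspace_dim :: "nat \<Rightarrow> real vec set \<Rightarrow> nat" where
  "subspace_dim n W = vectorspace.dim class_ring (module_vec TYPE(real) n\<lparr>carrier := W\<rparr>)"

definition ordered_basis :: "nat \<Rightarrow> real vec set \<Rightarrow> real vec list \<Rightarrow> bool" where
  "ordered_basis n W bs \<longleftrightarrow>
     distinct bs \<and> vectorspace.basis class_ring (module_vec TYPE(real) n\<lparr>carrier := W\<rparr>) (set bs)"

text \<open>
  Pluecker coordinates and Wronskians of a subspace are only defined up to a common nonzero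
  scalar, depending on a basis. We fix an arbitrary basis; every notion below that is built on it
  is invariant under such a rescaling.
\<close>

definition some_basis :: "nat \<Rightarrow> real vec set \<Rightarrow> real vec list" where
  "some_basis n W = (SOME bs. ordered_basis n W bs)"

definition plucker :: "nat \<Rightarrow> real vec set \<Rightarrow> nat set \<Rightarrow> real" where
  "plucker n W I = det (submatrix (mat_of_cols n (some_basis n W)) I UNIV)"

definition totally_nonneg :: "nat \<Rightarrow> real vec set \<Rightarrow> bool" where
  "totally_nonneg n W \<longleftrightarrow>
     (\<exists>c. c \<noteq> 0 \<and> (\<forall>I \<subseteq> {..<n}. card I = subspace_dim n W \<longrightarrow> c * plucker n W I \<ge> 0))"

definition totally_pos :: "nat \<Rightarrow> real vec set \<Rightarrow> bool" where
  "totally_pos n W \<longleftrightarrow>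
     (\<exists>c. c \<noteq> 0 \<and> (\<forall>I \<subseteq> {..<n}. card I = subspace_dim n W \<longrightarrow> c * plucker n W I > 0))"

text \<open>A flag is a function on indices, of which only the values at \<open>1, \<dots>, n - 1\<close> are relevant.\<close>

definition complete_flag :: "nat \<Rightarrow> (nat \<Rightarrow> real vec set) \<Rightarrow> bool" where
  "complete_flag n V \<longleftrightarrow>
     (\<forall>k \<in> {1..n - 1}. is_subspace n (V k) \<and> subspace_dim n (V k) = k) \<and>
     (\<forall>k. 1 \<le> k \<and> k + 1 \<le> n - 1 \<longrightarrow> V k \<subset> V (k + 1))"

definition totally_nonneg_flag :: "nat \<Rightarrow> (nat \<Rightarrow> real vec set) \<Rightarrow> bool" where
  "totally_nonneg_flag n V \<longleftrightarrow> (\<forall>k \<in> {1..n - 1}. totally_nonneg n (V k))"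

definition totally_pos_flag :: "nat \<Rightarrow> (nat \<Rightarrow> real vec set) \<Rightarrow> bool" where
  "totally_pos_flag n V \<longleftrightarrow> (\<forall>k \<in> {1..n - 1}. totally_pos n (V k))"

definition poly_of_coeffs :: "real vec \<Rightarrow> real poly" where
  "poly_of_coeffs v = (\<Sum>i<dim_vec v. monom (v $ i) i)"

definition wronskian :: "real poly list \<Rightarrow> real poly" where
  "wronskian fs = det (mat (length fs) (length fs) (\<lambda>(i, j). (pderiv ^^ i) (fs ! j)))"

text \<open>
  The isomorphism \<open>poly_of_coeffs\<close> from \<open>\<real>\<^sup>n\<close> onto the polynomials of degree less than \<open>n\<close> maps a
  basis of \<open>W\<close> to a basis of \<open>W\<close> viewed as a space of polynomials.
\<close>

definition Wr :: "nat \<Rightarrow> real vec set \<Rightarrow> real poly" where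
  "Wr n W = wronskian (map poly_of_coeffs (some_basis n W))"

end

theory Submission
  imports Defs
begin

text \<open>
  Cauchy-Binet expands the Wronskian of a subspace in its Pluecker coordinates:
  \<open>Wr = (\<Sum>I. \<Delta>\<^sub>I * vandermonde I * x ^ excess I)\<close> with \<open>vandermonde I > 0\<close> (\<open>Wr_expansion\<close>).
  Coordinates of one sign therefore cannot cancel at a point \<open>x > 0\<close>. The exponents \<open>0\<close> and
  \<open>k * (n - k)\<close> are the extreme ones and each belongs to one \<open>I\<close> only, namely \<open>{..<k}\<close> and
  \<open>{n - k..<n}\<close>; so these two extremal coordinates decide whether \<open>Wr\<close> vanishes at \<open>0\<close> or at
  \<open>\<infinity>\<close>. This proves that total nonnegativity and total positivity imply the conditions on \<open>Wr\<close>.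

  For the converse, let the polynomials \<open>f 0, f 1, \<dots>\<close> be adapted to the flag, so that the first \<open>k\<close>
  of them span \<open>V k\<close>. For \<open>0 < a < b = 1 / d\<close> the substitution \<open>x \<mapsto> (a + x) / (1 + d * x)\<close>
  carries \<open>[0, \<infinity>]\<close> to \<open>[a, b]\<close>, and pulling back along it gives a new flag for each \<open>a\<close>.
  Its extremal coordinates are nonzero multiples of the Wronskians at \<open>a\<close> and at \<open>b\<close>, so they never
  vanish. When \<open>a\<close> tends to \<open>b\<close>, the rescaled coordinates converge to those of the flag of
  multiples of powers of \<open>1 + d * x\<close>, which is totally positive: its coordinates are Vandermonde
  determinants times positive numbers, up to a factor common to each step of the flag
  (\<open>endpoint_minor_first\<close>). If \<open>a\<close> now moves away from \<open>b\<close>, total positivity persists. At the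
  first parameter where a coordinate vanished, the flag would be totally nonnegative with nonzero
  extremal coordinates, and such a flag is totally positive (\<open>nonneg_imp_positive\<close>); that is a
  combinatorial consequence of the three-term Pluecker relations
  (\<open>plucker_relations_flag_minor\<close>). Hence the pulled back flag is totally positive whenever
  \<open>0 < a < b\<close> (\<open>moebius_minors_same_sign\<close>). In the limit \<open>a \<rightarrow> 0\<close>, \<open>b \<rightarrow> \<infinity>\<close> the
  original flag is totally nonnegative. If moreover the Wronskians do not vanish at \<open>0\<close> and
  \<open>\<infinity>\<close>, its extremal coordinates are nonzero, and \<open>nonneg_imp_positive\<close> makes it
  totally positive.
\<close>

section \<open>Determinants and the Cauchy-Binet formula\<close>

text \<open>
  Matrices are given by their entry functions, which makes it possible to change entries and to
  select rows without reference to matrix dimensions.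
\<close>

definition det_fun :: "nat \<Rightarrow> (nat \<Rightarrow> nat \<Rightarrow> 'a :: comm_ring_1) \<Rightarrow> 'a" where
  "det_fun k a = det (mat k k (\<lambda>(i, j). a i j))"

lemma det_fun_Leibniz:
  "det_fun k a = (\<Sum>p | p permutes {0..<k}. signof p * (\<Prod>i = 0..<k. a i (p i)))"
proof -
  have "(\<Prod>i = 0..<k. mat k k (\<lambda>(i, j). a i j) $$ (i, p i)) = (\<Prod>i = 0..<k. a i (p i))"
    if "p permutes {0..<k}" for p
    using permutes_in_image[OF that] by (intro prod.cong) auto
  then show ?thesis
    unfolding det_fun_def by (subst det_def'[where n = k]) (auto intro!: sum.cong)
qed

lemma det_fun_cong:
  assumes "\<And>i j. i < k \<Longrightarrow> j < k \<Longrightarrow> a i j = b i j"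
  shows "det_fun k a = det_fun k b"
  unfolding det_fun_def by (intro arg_cong[where f = det] eq_matI) (auto simp: assms)

lemma det_fun_transpose: "det_fun k (\<lambda>i j. a j i) = det_fun k a"
proof -
  have "det (mat k k (\<lambda>(i, j). a i j))\<^sup>T = det (mat k k (\<lambda>(i, j). a i j))"
    by (rule det_transpose[where n = k]) simp
  moreover have "(mat k k (\<lambda>(i, j). a i j))\<^sup>T = mat k k (\<lambda>(i, j). a j i)"
    by (intro eq_matI) auto
  ultimately show ?thesis unfolding det_fun_def by simp
qed

lemma det_fun_scale_rows: "det_fun k (\<lambda>i j. r i * a i j) = (\<Prod>i<k. r i) * det_fun k a"
  unfolding det_fun_Leibniz sum_distrib_left
  by (intro sum.cong) (auto simp: prod.distrib atLeast0LessThan mult_ac)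

lemma det_fun_scale_cols: "det_fun k (\<lambda>i j. r j * a i j) = (\<Prod>j<k. r j) * det_fun k a"
  using det_fun_scale_rows[of k r "\<lambda>i j. a j i"] det_fun_transpose[of k "\<lambda>i j. r j * a i j"]
    det_fun_transpose[of k a] by simp

lemma det_fun_mult:
  "det_fun k (\<lambda>i j. \<Sum>m<k. a i m * b m j) = det_fun k a * det_fun k b"
proof -
  have "mat k k (\<lambda>(i, j). \<Sum>m<k. a i m * b m j)
      = mat k k (\<lambda>(i, j). a i j) * mat k k (\<lambda>(i, j). b i j)"
    by (intro eq_matI) (auto simp: scalar_prod_def atLeast0LessThan)
  then show ?thesis
    unfolding det_fun_def by (simp add: det_mult[where n = k])
qed

lemma prod_list_diag_mat: "prod_list (diag_mat (mat k k (\<lambda>(i, j). a i j))) = (\<Prod>i<k. a i i)"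
proof -
  have "diag_mat (mat k k (\<lambda>(i, j). a i j)) = map (\<lambda>i. a i i) [0..<k]"
    by (auto simp: diag_mat_def)
  then show ?thesis
    by (simp add: prod.distinct_set_conv_list[symmetric] atLeast0LessThan)
qed

lemma det_fun_upper_triangular:
  assumes "\<And>i j. j < i \<Longrightarrow> i < k \<Longrightarrow> a i j = 0"
  shows "det_fun k a = (\<Prod>i<k. a i i)"
proof -
  have "upper_triangular (mat k k (\<lambda>(i, j). a i j))" using assms by auto
  from det_upper_triangular[OF this, of k] show ?thesis
    by (simp add: det_fun_def prod_list_diag_mat)
qed

lemma det_fun_lower_triangular:
  assumes "\<And>i j. i < j \<Longrightarrow> j < k \<Longrightarrow> a i j = 0"
  shows "det_fun k a = (\<Prod>i<k. a i i)"
  using det_fun_upper_triangular[of k "\<lambda>i j. a j i"] det_fun_transpose[of k a] assms by simp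

lemma det_fun_permute_rows:
  assumes "p permutes {0..<k}"
  shows "det_fun k (\<lambda>i j. a (p i) j) = signof p * det_fun k a"
proof -
  have "det (mat k k (\<lambda>(i, j). mat k k (\<lambda>(i, j). a i j) $$ (p i, j))) = signof p * det_fun k a"
    unfolding det_fun_def by (rule det_permute_rows) (use assms in auto)
  moreover have "mat k k (\<lambda>(i, j). mat k k (\<lambda>(i, j). a i j) $$ (p i, j)) = mat k k (\<lambda>(i, j). a (p i) j)"
    using permutes_in_image[OF assms] by (intro eq_matI) auto
  ultimately show ?thesis by (simp add: det_fun_def)
qed

lemma det_fun_identical_rows:
  assumes "i \<noteq> i'" "i < k" "i' < k" "\<And>j. j < k \<Longrightarrow> a i j = a i' j"
  shows "det_fun k a = 0"
  unfolding det_fun_def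
  by (rule det_identical_rows[where n = k and i = i and j = i']) (use assms in auto)

lemma pick_less:
  assumes "I \<subseteq> {..<n}" "p < card I"
  shows "pick I p < n"
  using pick_in_set_le[OF assms(2)] assms(1) by auto

lemma pick_strict_mono: "p < q \<Longrightarrow> q < card I \<Longrightarrow> pick I p < pick I q"
  by (rule pick_mono_le)

lemma bij_betw_pick:
  assumes "finite I"
  shows "bij_betw (pick I) {..<card I} I"
proof -
  have inj: "inj_on (pick I) {..<card I}"
    by (rule linorder_inj_onI) (use pick_strict_mono[of _ _ I] in fastforce)+
  have sub: "pick I ` {..<card I} \<subseteq> I" using pick_in_set_le by auto
  have "pick I ` {..<card I} = I"
    by (rule card_subset_eq) (use assms sub card_image[OF inj] in auto)
  with inj show ?thesis by (simp add: bij_betw_def)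
qed

abbreviation rows_of_size :: "nat \<Rightarrow> nat \<Rightarrow> nat set set" where
  "rows_of_size n k \<equiv> {I. I \<subseteq> {..<n} \<and> card I = k}"

text \<open>
  Multilinearity in the rows gives one term for each map \<open>\<phi>\<close> from rows of \<open>a\<close> to
  summation indices. Maps that are not injective contribute a determinant with two equal rows, and the
  injective ones with image \<open>I\<close> are \<open>pick I \<circ> \<pi>\<close> for the permutations \<open>\<pi>\<close>, so that
  they add up to the product of the two minors.
\<close>

theorem Cauchy_Binet:
  fixes a b :: "nat \<Rightarrow> nat \<Rightarrow> 'a :: comm_ring_1"
  shows "det_fun k (\<lambda>i j. \<Sum>m<n. a i m * b m j) =
    (\<Sum>I\<in>rows_of_size n k. det_fun k (\<lambda>i p. a i (pick I p)) * det_fun k (\<lambda>p j. b (pick I p) j))"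
proof -
  let ?K = "{0..<k}" and ?F = "PiE {0..<k} (\<lambda>_. {..<n})"
  let ?P = "{\<pi>. \<pi> permutes ?K}"
  let ?t = "\<lambda>\<phi>. (\<Prod>i\<in>?K. a i (\<phi> i)) * det_fun k (\<lambda>i j. b (\<phi> i) j)"
  have finP: "finite ?P" by (simp add: finite_permutations)
  have finF: "finite ?F" by (simp add: finite_PiE)
  have "det_fun k (\<lambda>i j. \<Sum>m<n. a i m * b m j)
      = (\<Sum>\<pi>\<in>?P. signof \<pi> * (\<Sum>\<phi>\<in>?F. \<Prod>i\<in>?K. a i (\<phi> i) * b (\<phi> i) (\<pi> i)))"
    unfolding det_fun_Leibniz by (subst prod_sum_PiE) auto
  also have "\<dots> = (\<Sum>\<phi>\<in>?F. \<Sum>\<pi>\<in>?P. signof \<pi> * (\<Prod>i\<in>?K. a i (\<phi> i) * b (\<phi> i) (\<pi> i)))"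
    unfolding sum_distrib_left by (rule sum.swap)
  also have "\<dots> = sum ?t ?F"
    by (intro sum.cong) (auto simp: det_fun_Leibniz sum_distrib_left prod.distrib mult_ac)
  also have "\<dots> = sum ?t {\<phi>\<in>?F. inj_on \<phi> ?K}"
  proof (rule sum.mono_neutral_right[OF finF])
    show "\<forall>\<phi>\<in>?F - {\<phi>\<in>?F. inj_on \<phi> ?K}. ?t \<phi> = 0"
    proof
      fix \<phi> assume "\<phi> \<in> ?F - {\<phi>\<in>?F. inj_on \<phi> ?K}"
      then obtain i i' where "i \<noteq> i'" "i < k" "i' < k" "\<phi> i = \<phi> i'" by (auto simp: inj_on_def)
      then have "det_fun k (\<lambda>i j. b (\<phi> i) j) = 0"
        by (intro det_fun_identical_rows[of i i']) auto
      then show "?t \<phi> = 0" by simp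
    qed
  qed auto
  also have "\<dots> = (\<Sum>I\<in>rows_of_size n k. \<Sum>\<phi>\<in>{\<phi>\<in>{\<phi>\<in>?F. inj_on \<phi> ?K}. \<phi> ` ?K = I}. ?t \<phi>)"
    by (rule sum.group[symmetric]) (use finite_subset[OF _ finF] in \<open>auto simp: card_image\<close>)
  also have "\<dots> = (\<Sum>I\<in>rows_of_size n k. det_fun k (\<lambda>i p. a i (pick I p)) * det_fun k (\<lambda>p j. b (pick I p) j))"
  proof (rule sum.cong[OF refl])
    fix I assume "I \<in> rows_of_size n k"
    then have I: "I \<subseteq> {..<n}" "card I = k" by auto
    then have "finite I" using finite_subset by blast
    from bij_betw_pick[OF this] I(2) have bij: "bij_betw (pick I) ?K I"
      by (simp add: atLeast0LessThan)
    let ?h = "\<lambda>\<pi>. restrict (pick I \<circ> \<pi>) ?K"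
    have "bij_betw ?h ?P {\<phi>\<in>{\<phi>\<in>?F. inj_on \<phi> ?K}. \<phi> ` ?K = I}"
    proof (rule bij_betwI')
      fix \<pi> \<pi>' assume p: "\<pi> \<in> ?P" "\<pi>' \<in> ?P"
      show "(?h \<pi> = ?h \<pi>') = (\<pi> = \<pi>')"
      proof
        assume eq: "?h \<pi> = ?h \<pi>'"
        show "\<pi> = \<pi>'"
        proof
          fix i show "\<pi> i = \<pi>' i"
          proof (cases "i \<in> ?K")
            case True
            then have "pick I (\<pi> i) = pick I (\<pi>' i)" using fun_cong[OF eq, of i] by simp
            moreover have "\<pi> i \<in> ?K" "\<pi>' i \<in> ?K"
              using permutes_in_image[of \<pi> ?K i] permutes_in_image[of \<pi>' ?K i] p True by simp_all
            ultimately show ?thesis using bij inj_onD[of "pick I" ?K] unfolding bij_betw_def by blast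
          next
            case False
            then show ?thesis using p permutes_not_in[of \<pi> ?K i] permutes_not_in[of \<pi>' ?K i] by simp
          qed
        qed
      qed auto
    next
      fix \<pi> assume "\<pi> \<in> ?P"
      then have "bij_betw \<pi> ?K ?K" by (auto simp: permutes_imp_bij)
      from bij_betw_trans[OF this bij] have "bij_betw (?h \<pi>) ?K I"
        by (subst bij_betw_cong[where g = "pick I \<circ> \<pi>"]) auto
      then show "?h \<pi> \<in> {\<phi>\<in>{\<phi>\<in>?F. inj_on \<phi> ?K}. \<phi> ` ?K = I}"
        using I by (auto simp: bij_betw_def)
    next
      fix \<phi> assume "\<phi> \<in> {\<phi>\<in>{\<phi>\<in>?F. inj_on \<phi> ?K}. \<phi> ` ?K = I}"
      then have \<phi>: "bij_betw \<phi> ?K I" "\<phi> \<in> ?F" by (auto simp: bij_betw_def)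
      let ?\<pi> = "\<lambda>i. if i \<in> ?K then inv_into ?K (pick I) (\<phi> i) else i"
      have "bij_betw (inv_into ?K (pick I) \<circ> \<phi>) ?K ?K"
        using bij_betw_trans[OF \<phi>(1) bij_betw_inv_into[OF bij]] .
      then have "bij_betw ?\<pi> ?K ?K"
        by (subst bij_betw_cong[where g = "inv_into ?K (pick I) \<circ> \<phi>"]) auto
      then have "?\<pi> permutes ?K" by (intro bij_imp_permutes) auto
      moreover have "\<phi> = ?h ?\<pi>"
      proof
        fix i show "\<phi> i = ?h ?\<pi> i"
        proof (cases "i \<in> ?K")
          case True
          then have "\<phi> i \<in> pick I ` ?K" using \<phi>(1) bij by (auto simp: bij_betw_def)
          then show ?thesis using True by (simp add: f_inv_into_f del: atLeastLessThan_iff)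
        next
          case False
          then show ?thesis using \<phi>(2) by (auto simp: PiE_def extensional_def)
        qed
      qed
      ultimately show "\<exists>\<pi>\<in>?P. \<phi> = ?h \<pi>" by blast
    qed
    then have "(\<Sum>\<phi>\<in>{\<phi>\<in>{\<phi>\<in>?F. inj_on \<phi> ?K}. \<phi> ` ?K = I}. ?t \<phi>) = (\<Sum>\<pi>\<in>?P. ?t (?h \<pi>))"
      by (simp add: sum.reindex_bij_betw[symmetric])
    also have "\<dots> = (\<Sum>\<pi>\<in>?P. signof \<pi> * (\<Prod>i\<in>?K. a i (pick I (\<pi> i))) * det_fun k (\<lambda>p j. b (pick I p) j))"
    proof (rule sum.cong[OF refl])
      fix \<pi> assume "\<pi> \<in> ?P"
      then have "det_fun k (\<lambda>i j. b (pick I (\<pi> i)) j) = signof \<pi> * det_fun k (\<lambda>p j. b (pick I p) j)"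
        using det_fun_permute_rows[of \<pi> k "\<lambda>p j. b (pick I p) j"] by simp
      moreover have "det_fun k (\<lambda>i j. b (?h \<pi> i) j) = det_fun k (\<lambda>i j. b (pick I (\<pi> i)) j)"
        by (rule det_fun_cong) auto
      ultimately show "?t (?h \<pi>) = signof \<pi> * (\<Prod>i\<in>?K. a i (pick I (\<pi> i))) * det_fun k (\<lambda>p j. b (pick I p) j)"
        by (simp add: mult_ac)
    qed
    also have "\<dots> = det_fun k (\<lambda>i p. a i (pick I p)) * det_fun k (\<lambda>p j. b (pick I p) j)"
      by (simp add: det_fun_Leibniz[of k "\<lambda>i p. a i (pick I p)"] sum_distrib_right)
    finally show "(\<Sum>\<phi>\<in>{\<phi>\<in>{\<phi>\<in>?F. inj_on \<phi> ?K}. \<phi> ` ?K = I}. ?t \<phi>) =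
      det_fun k (\<lambda>i p. a i (pick I p)) * det_fun k (\<lambda>p j. b (pick I p) j)" .
  qed
  finally show ?thesis .
qed

section \<open>From nonnegative to positive flags\<close>

text \<open>
  The three-term relations between the coordinates of two consecutive subspaces of a flag. They
  are stated for an arbitrary function on subsets of an interval, so that they pass to the
  restriction to sets without \<open>l\<close> (deletion) and to sets with \<open>l\<close> (contraction); this is what
  the induction in \<open>nonneg_imp_positive\<close> runs on.
\<close>

definition plucker_relations :: "nat \<Rightarrow> nat \<Rightarrow> (nat set \<Rightarrow> real) \<Rightarrow> bool" where
  "plucker_relations l u D \<longleftrightarrow>
     (\<forall>J a b c. J \<subseteq> {l..<u} \<longrightarrow> l \<le> a \<longrightarrow> a < b \<longrightarrow> b < c \<longrightarrow> c < u \<longrightarrow> a \<notin> J \<longrightarrow> b \<notin> J \<longrightarrow> c \<notin> J \<longrightarrow>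
        D (insert b J) * D (insert a (insert c J)) =
        D (insert a J) * D (insert b (insert c J)) + D (insert c J) * D (insert a (insert b J)))"

lemma plucker_relationsD:
  assumes "plucker_relations l u D" "J \<subseteq> {l..<u}" "l \<le> a" "a < b" "b < c" "c < u"
    "a \<notin> J" "b \<notin> J" "c \<notin> J"
  shows "D (insert b J) * D (insert a (insert c J)) =
    D (insert a J) * D (insert b (insert c J)) + D (insert c J) * D (insert a (insert b J))"
  using assms unfolding plucker_relations_def by blast

lemma plucker_relations_deletion:
  "plucker_relations l u D \<Longrightarrow> plucker_relations (Suc l) u D"
  unfolding plucker_relations_def
proof (intro allI impI, elim allE impE)
  fix J a b c
  assume "J \<subseteq> {Suc l..<u}" "Suc l \<le> a"
  then show "J \<subseteq> {l..<u}" "l \<le> a" by fastforce+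
qed

lemma plucker_relations_contraction:
  assumes "plucker_relations l u D"
  shows "plucker_relations (Suc l) u (\<lambda>I. D (insert l I))"
  unfolding plucker_relations_def
proof (intro allI impI)
  fix J a b c
  assume *: "J \<subseteq> {Suc l..<u}" "Suc l \<le> a" "a < b" "b < c" "c < u" "a \<notin> J" "b \<notin> J" "c \<notin> J"
  have "J \<subseteq> {l..<u}" using *(1) by fastforce
  with * have "insert l J \<subseteq> {l..<u}" "a \<notin> insert l J" "b \<notin> insert l J" "c \<notin> insert l J" by auto
  from plucker_relationsD[OF assms this(1) _ *(3-5) this(2-)] *(2)
  show "D (insert l (insert b J)) * D (insert l (insert a (insert c J))) =
    D (insert l (insert a J)) * D (insert l (insert b (insert c J))) +
    D (insert l (insert c J)) * D (insert l (insert a (insert b J)))"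
    by (simp add: insert_commute[of l])
qed

lemma pos_of_mult_ge:
  fixes p q r s :: real
  assumes "p * q = r + s" "r > 0" "s \<ge> 0" "p \<ge> 0"
  shows "q > 0" "p > 0"
  using assms by (smt (verit) mult_nonneg_nonpos mult_nonpos_nonneg zero_less_mult_iff)+

lemma card_insert_le_Suc: "card (insert x A) \<le> Suc (card A)"
  by (cases "finite A") (auto simp: card_insert_if)

text \<open>
  Induction on the length of the interval: sets that avoid the least element \<open>l\<close> are handled by
  deletion of \<open>l\<close>, sets that contain it by contraction. The only thing to verify is that the
  extremal values needed for the two smaller instances are positive. Those that are not extremal for
  \<open>D\<close> itself come from three-term relations in which one summand on the right is a product of
  values already known to be positive.
\<close>

lemma nonneg_imp_positive:
  assumes "plucker_relations l u D"
    and "\<And>I. I \<subseteq> {l..<u} \<Longrightarrow> card I < u - l \<Longrightarrow> D I \<ge> 0"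
    and "\<And>k. k < u - l \<Longrightarrow> D {l..<l + k} > 0"
    and "\<And>k. k < u - l \<Longrightarrow> D {u - k..<u} > 0"
    and "I \<subseteq> {l..<u}" "card I < u - l"
  shows "D I > 0"
  using assms
proof (induction "u - l" arbitrary: l D I)
  case 0
  from 0(1,7) show ?case by linarith
next
  case (Suc n)
  note rel = plucker_relationsD[OF Suc.prems(1)]
  note nonneg = Suc.prems(2) and first = Suc.prems(3) and last = Suc.prems(4)
  have u: "u = Suc (l + n)" using Suc.hyps(2) by simp
  \<comment> \<open>Initial intervals for the deletion, by descending induction on \<open>k\<close> from the final
    interval \<open>{Suc l..<u}\<close>.\<close>
  have p: "D {Suc l..<Suc l + k} > 0" if "k \<le> n" for k
    using that
  proof (induction k rule: inc_induct)
    case base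
    then show ?case using last[of n] u by simp
  next
    case (step k)
    show ?case
    proof (cases k)
      case 0
      then show ?thesis using first[of 0] Suc.hyps(2) by simp
    next
      case (Suc k')
      let ?J = "{Suc l..<l + k}"
      have sets: "insert (l + k) ?J = {Suc l..<Suc l + k}" "insert l ?J = {l..<l + k}"
          "insert (l + k) (insert (Suc (l + k)) ?J) = {Suc l..<Suc l + Suc k}"
          "insert l (insert (l + k) ?J) = {l..<l + Suc k}"
        using Suc by auto
      have "D (insert (l + k) ?J) * D (insert l (insert (Suc (l + k)) ?J)) =
          D {l..<l + k} * D {Suc l..<Suc l + Suc k}
          + D (insert (Suc (l + k)) ?J) * D {l..<l + Suc k}"
        unfolding sets[symmetric] by (rule rel) (use Suc step.hyps u in auto)
      moreover have "D {l..<l + k} * D {Suc l..<Suc l + Suc k} > 0"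
        using first[of k] step u by simp
      moreover have "D (insert (Suc (l + k)) ?J) * D {l..<l + Suc k} \<ge> 0"
        by (intro mult_nonneg_nonneg nonneg) (use Suc step u in \<open>auto simp: card_insert_if\<close>)
      moreover have "D (insert (l + k) ?J) \<ge> 0"
        by (rule nonneg) (use Suc step u in \<open>auto simp: card_insert_if\<close>)
      ultimately have "D (insert (l + k) ?J) > 0" by (rule pos_of_mult_ge)
      then show ?thesis unfolding sets .
    qed
  qed
  \<comment> \<open>Final intervals for the contraction, by ascending induction on \<open>k\<close> from \<open>{l}\<close>.\<close>
  have q: "D (insert l {u - k..<u}) > 0" if "k < n" for k
    using that
  proof (induction k)
    case 0
    then show ?case using first[of 1] u by simp
  next
    case (Suc k)
    let ?J = "{u - k..<u}" and ?b = "u - k - 2" and ?c = "u - k - 1"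
    have sets: "insert ?c ?J = {u - Suc k..<u}" "insert ?b (insert ?c ?J) = {u - (k + 2)..<u}"
      using Suc.prems u by auto
    have "D (insert ?b ?J) * D (insert l (insert ?c ?J)) =
        D (insert l ?J) * D (insert ?b (insert ?c ?J)) + D (insert ?c ?J) * D (insert l (insert ?b ?J))"
      by (rule rel) (use Suc.prems u in auto)
    moreover have "D (insert l ?J) * D (insert ?b (insert ?c ?J)) > 0"
      unfolding sets(2) using Suc last[of "k + 2"] u by simp
    moreover have "D (insert ?c ?J) \<ge> 0"
      by (rule nonneg) (use Suc.prems u card_insert_le_Suc[of ?c ?J] in auto)
    moreover have "D (insert l (insert ?b ?J)) \<ge> 0"
      by (rule nonneg) (use Suc.prems u card_insert_le_Suc[of ?b ?J]
        card_insert_le_Suc[of l "insert ?b ?J"] in auto)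
    moreover have "D (insert ?b ?J) \<ge> 0"
      by (rule nonneg) (use Suc.prems u card_insert_le_Suc[of ?b ?J] in auto)
    ultimately have "D (insert l (insert ?c ?J)) > 0"
      using pos_of_mult_ge(1) mult_nonneg_nonneg by blast
    then show ?case unfolding sets .
  qed
  have ground: "{l..<u} - {l} = {Suc l..<u}" by auto
  have fin: "finite I" using Suc.prems(5) finite_subset by blast
  show ?case
  proof (cases "l \<in> I")
    case True
    let ?I = "I - {l}"
    have I: "insert l ?I = I" "Suc (card ?I) = card I" "?I \<subseteq> {Suc l..<u}"
      using True fin Suc.prems(5) ground by (auto simp: card_Suc_Diff1 simp del: card_Diff_insert)
    have ci: "card (insert l I) = Suc (card I)" if "I \<subseteq> {Suc l..<u}" for I
      using that finite_subset[OF that] by (subst card_insert_disjoint) auto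
    have "D (insert l ?I) > 0"
    proof (rule Suc.hyps(1)[OF _ plucker_relations_contraction[OF Suc.prems(1)]])
      show "D (insert l I) \<ge> 0" if "I \<subseteq> {Suc l..<u}" "card I < u - Suc l" for I
        by (rule nonneg) (use that ci[OF that(1)] u in \<open>auto simp: subset_iff\<close>)
      show "D (insert l {Suc l..<Suc l + k}) > 0" if "k < u - Suc l" for k
      proof -
        have "insert l {Suc l..<Suc l + k} = {l..<l + Suc k}" by auto
        then show ?thesis using first[of "Suc k"] that u by simp
      qed
      show "D (insert l {u - k..<u}) > 0" if "k < u - Suc l" for k
        using q that u by simp
      show "card ?I < u - Suc l" using I(2) Suc.prems(6) by simp
    qed (use I u in auto)
    then show ?thesis using I by simp
  next
    case False
    then have I: "I \<subseteq> {Suc l..<u}" using Suc.prems(5) ground by blast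
    show ?thesis
    \<comment> \<open>A set of this size is not covered by the deletion, but it can only be the
      extremal set \<open>{Suc l..<u}\<close>.\<close>
    proof (cases "card I = n")
      case True
      then have "I = {Suc l..<u}" using I u by (intro card_subset_eq) auto
      then show ?thesis using last[of n] u by simp
    next
      case card: False
      show ?thesis
      proof (rule Suc.hyps(1)[OF _ plucker_relations_deletion[OF Suc.prems(1)]])
        show "D I \<ge> 0" if "I \<subseteq> {Suc l..<u}" "card I < u - Suc l" for I
          by (rule nonneg) (use that u in \<open>auto simp: subset_iff\<close>)
      qed (use p last I card Suc.prems(6) u in auto)
    qed
  qed
qed

text \<open>
  Each product in a three-term relation has one factor for a set of size \<open>card J + 1\<close> and one for
  size \<open>card J + 2\<close>, so the coordinates of each step of a flag may be rescaled separately.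
\<close>

lemma plucker_relations_scale:
  assumes "plucker_relations l u D"
  shows "plucker_relations l u (\<lambda>I. \<sigma> (card I) * D I)"
  unfolding plucker_relations_def
proof (intro allI impI)
  fix J a b c
  assume *: "J \<subseteq> {l..<u}" "l \<le> a" "a < b" "b < c" "c < u" "a \<notin> J" "b \<notin> J" "c \<notin> J"
  then have "finite J" using finite_subset by blast
  with * have card: "card (insert a J) = Suc (card J)" "card (insert b J) = Suc (card J)"
    "card (insert c J) = Suc (card J)" "card (insert a (insert b J)) = Suc (Suc (card J))"
    "card (insert a (insert c J)) = Suc (Suc (card J))" "card (insert b (insert c J)) = Suc (Suc (card J))"
    by auto
  show "\<sigma> (card (insert b J)) * D (insert b J) * (\<sigma> (card (insert a (insert c J))) * D (insert a (insert c J))) =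
     \<sigma> (card (insert a J)) * D (insert a J) * (\<sigma> (card (insert b (insert c J))) * D (insert b (insert c J))) +
     \<sigma> (card (insert c J)) * D (insert c J) * (\<sigma> (card (insert a (insert b J))) * D (insert a (insert b J)))"
    unfolding card
    using arg_cong[OF plucker_relationsD[OF assms(1) *], of "\<lambda>t. \<sigma> (Suc (card J)) * \<sigma> (Suc (Suc (card J))) * t"]
    by (simp only: distrib_left mult_ac)
qed

section \<open>Three-term Pluecker relations between minors\<close>

text \<open>
  For fixed rows \<open>r\<close> this is an alternating bilinear form in the two last rows.
\<close>

definition bordered :: "nat \<Rightarrow> (nat \<Rightarrow> nat \<Rightarrow> real) \<Rightarrow> (nat \<Rightarrow> real) \<Rightarrow> (nat \<Rightarrow> real) \<Rightarrow> real" where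
  "bordered k r u v = det_fun (Suc (Suc k)) (\<lambda>i. if i < k then r i else if i = k then u else v)"

lemma det_fun_two_last_rows:
  fixes c :: "nat \<Rightarrow> nat \<Rightarrow> real"
  assumes "\<And>i j. i < k \<Longrightarrow> c i j = (if i = j then 1 else 0)"
  shows "det_fun (Suc (Suc k)) c = c k k * c (Suc k) (Suc k) - c k (Suc k) * c (Suc k) k"
proof -
  let ?A = "mat 2 2 (\<lambda>(i, j). c (k + i) (k + j))"
  have "mat (Suc (Suc k)) (Suc (Suc k)) (\<lambda>(i, j). c i j)
      = four_block_mat (1\<^sub>m k) (0\<^sub>m k 2) (mat 2 k (\<lambda>(i, j). c (k + i) j)) ?A"
    by (intro eq_matI) (auto simp: assms)
  then have "det_fun (Suc (Suc k)) c = det (1\<^sub>m k) * det ?A"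
    unfolding det_fun_def by (simp only:) (rule det_four_block_mat_upper_right_zero, auto)
  also have "det ?A = c k k * c (Suc k) (Suc k) - c k (Suc k) * c (Suc k) k"
  proof -
    have "cofactor ?A 0 j = (if j = 0 then ?A $$ (1, 1) else - ?A $$ (1, 0))" if "j < 2" for j
      using that unfolding cofactor_def
      by (subst det_single) (auto simp: mat_delete_def less_2_cases_iff)
    then show ?thesis
      by (subst laplace_expansion_row[of _ 2 0]) (auto simp: numeral_2_eq_2)
  qed
  finally show ?thesis by simp
qed

text \<open>
  If the form is not zero, choose last rows \<open>x\<close> and \<open>w\<close> that give an invertible matrix \<open>M\<close>.
  Written in coordinates with respect to the rows of \<open>M\<close>, any other choice of last rows only
  changes the determinant by the 2 by 2 minor of their coordinates along \<open>x\<close> and \<open>w\<close>.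
\<close>

lemma bordered_rank_two:
  obtains d \<alpha> \<beta> where "\<And>u v. bordered k r u v = d * (\<alpha> u * \<beta> v - \<beta> u * \<alpha> v)"
proof (cases "\<exists>u v. bordered k r u v \<noteq> 0")
  case False
  then show ?thesis by (intro that[of 0 "\<lambda>_. 0" "\<lambda>_. 0"]) auto
next
  case True
  then obtain x w where xw: "bordered k r x w \<noteq> 0" by blast
  let ?m = "Suc (Suc k)"
  let ?rows = "\<lambda>u v i. if i < k then r i else if i = k then u else v"
  define M where "M = mat ?m ?m (\<lambda>(i, j). ?rows x w i j)"
  have M: "M \<in> carrier_mat ?m ?m" "det M \<noteq> 0"
    using xw by (auto simp: M_def bordered_def det_fun_def)
  then have "M \<in> Units (ring_mat TYPE(real) ?m ())" by (rule det_non_zero_imp_unit)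
  then obtain B where B: "B \<in> carrier_mat ?m ?m" "M * B = 1\<^sub>m ?m" "B * M = 1\<^sub>m ?m"
    by (auto simp: Units_def ring_mat_def)
  \<comment> \<open>Coordinates of \<open>u\<close> with respect to the rows of \<open>M\<close>.\<close>
  define co where "co u j = (\<Sum>l<?m. u l * B $$ (l, j))" for u j
  have MB: "co (?rows x w i) j = (if i = j then 1 else 0)" if "i < k" "j < ?m" for i j
  proof -
    have "(M * B) $$ (i, j) = (\<Sum>l<?m. M $$ (i, l) * B $$ (l, j))"
      using that M(1) B(1) by (auto simp: scalar_prod_def atLeast0LessThan simp del: sum.lessThan_Suc)
    then show ?thesis using that B(2) by (simp add: M_def co_def del: sum.lessThan_Suc)
  qed
  have BM: "u j = (\<Sum>l<?m. co u l * M $$ (l, j))" if "j < ?m" for u j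
  proof -
    have "(\<Sum>l<?m. co u l * M $$ (l, j)) = (\<Sum>i<?m. u i * (\<Sum>l<?m. B $$ (i, l) * M $$ (l, j)))"
      unfolding co_def sum_distrib_left sum_distrib_right by (subst sum.swap) (simp add: mult_ac)
    also have "\<dots> = (\<Sum>i<?m. u i * (B * M) $$ (i, j))"
      using that M(1) B(1) by (intro sum.cong) (auto simp: scalar_prod_def atLeast0LessThan simp del: sum.lessThan_Suc)
    also have "\<dots> = (\<Sum>i<?m. if i = j then u i else 0)"
      using that B(3) by (intro sum.cong) auto
    also have "\<dots> = u j" using that by (subst sum.delta) auto
    finally show ?thesis by simp
  qed
  have "bordered k r u v = bordered k r x w * (co u k * co v (Suc k) - co u (Suc k) * co v k)" for u v
  proof -
    let ?c = "\<lambda>i j. if j < ?m then co (?rows u v i) j else if i = j then 1 else 0"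
    have "bordered k r u v = det_fun ?m (\<lambda>i j. \<Sum>l<?m. ?c i l * M $$ (l, j))"
      unfolding bordered_def
    proof (rule det_fun_cong)
      fix i j assume ij: "i < ?m" "j < ?m"
      have "?rows u v i j = (\<Sum>l<?m. co (?rows u v i) l * M $$ (l, j))" using BM[OF ij(2)] .
      also have "\<dots> = (\<Sum>l<?m. ?c i l * M $$ (l, j))" by (intro sum.cong) auto
      finally show "?rows u v i j = (\<Sum>l<?m. ?c i l * M $$ (l, j))" .
    qed
    also have "\<dots> = det_fun ?m ?c * det_fun ?m (\<lambda>l j. M $$ (l, j))" by (rule det_fun_mult)
    also have "det_fun ?m ?c = co u k * co v (Suc k) - co u (Suc k) * co v k"
    proof (subst det_fun_two_last_rows)
      fix i j assume "i < k"
      then show "?c i j = (if i = j then 1 else 0)" using MB[of i j] by (cases "i = j") auto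
    qed auto
    also have "det_fun ?m (\<lambda>l j. M $$ (l, j)) = bordered k r x w"
      unfolding bordered_def by (rule det_fun_cong) (auto simp: M_def)
    finally show ?thesis by (simp only: mult.commute)
  qed
  then show ?thesis by (rule that)
qed

text \<open>
  After \<open>bordered_rank_two\<close> this is the Pluecker relation between the 2 by 2 minors of a
  matrix with two rows and four columns.
\<close>

lemma Grassmann_Plucker:
  "bordered k r x y * bordered k r z w - bordered k r x z * bordered k r y w
     + bordered k r x w * bordered k r y z = 0"
proof -
  obtain d \<alpha> \<beta> where eq: "\<And>u v. bordered k r u v = d * (\<alpha> u * \<beta> v - \<beta> u * \<alpha> v)"
    by (rule bordered_rank_two[of k r]) blast
  show ?thesis unfolding eq by (simp add: algebra_simps)
qed

text \<open>
  The Pluecker coordinate \<open>I\<close> of the span of the first \<open>card I\<close> columns. A single function on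
  all finite sets thus records the coordinates of every step of a flag.
\<close>

definition flag_minor :: "(nat \<Rightarrow> nat \<Rightarrow> real) \<Rightarrow> nat set \<Rightarrow> real" where
  "flag_minor a I = det_fun (card I) (\<lambda>p j. a (pick I p) j)"

text \<open>
  Rows in the order of a list: the Grassmann-Pluecker relation places the distinguished rows last,
  and the signs for sorting them into place are computed on lists.
\<close>

definition list_minor :: "(nat \<Rightarrow> nat \<Rightarrow> real) \<Rightarrow> nat list \<Rightarrow> real" where
  "list_minor a xs = det_fun (length xs) (\<lambda>p j. a (xs ! p) j)"

lemma flag_minor_eq_list_minor:
  assumes "finite I"
  shows "flag_minor a I = list_minor a (sorted_list_of_set I)"
proof -
  have "sorted_wrt (<) (map (pick I) [0..<card I])"
    by (auto simp: sorted_wrt_iff_nth_less pick_strict_mono)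
  moreover have "set (map (pick I) [0..<card I]) = I"
    using bij_betw_pick[OF assms] by (auto simp: bij_betw_def atLeast0LessThan)
  ultimately have "sorted_list_of_set I = map (pick I) [0..<card I]"
    using assms strict_sorted_equal[OF strict_sorted_list_of_set, of "map (pick I) [0..<card I]" I] by simp
  then show ?thesis
    unfolding flag_minor_def list_minor_def by (auto intro!: det_fun_cong)
qed

lemma list_minor_swap:
  "list_minor a (us @ x # v # vs) = - list_minor a (us @ v # x # vs)"
proof -
  let ?p = "Transposition.transpose (length us) (Suc (length us))" and ?n = "length (us @ v # x # vs)"
  have "det_fun ?n (\<lambda>i j. a ((us @ v # x # vs) ! ?p i) j) =
      signof ?p * det_fun ?n (\<lambda>i j. a ((us @ v # x # vs) ! i) j)"
    by (rule det_fun_permute_rows) (rule permutes_swap_id, auto)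
  moreover have "(us @ v # x # vs) ! ?p i = (us @ x # v # vs) ! i" for i
    by (auto simp: Transposition.transpose_def nth_append nth_Cons')
  ultimately show ?thesis
    by (simp add: list_minor_def sign_swap_id)
qed

lemma list_minor_rotate:
  "list_minor a (us @ x # vs) = (-1) ^ length vs * list_minor a (us @ vs @ [x])"
proof (induction vs arbitrary: us)
  case (Cons v vs)
  show ?case
    using list_minor_swap[of a us x v vs] Cons.IH[of "us @ [v]"] by simp
qed simp

lemma insort_split:
  assumes "sorted xs" "(x :: nat) \<notin> set xs"
  obtains us vs where "xs = us @ vs" "insort x xs = us @ x # vs" "length vs = length (filter (\<lambda>y. x < y) xs)"
  using assms
proof (induction xs arbitrary: thesis)
  case (Cons y xs)
  show ?case
  proof (cases "x < y")
    case True
    then have "\<forall>z\<in>set xs. x < z" using Cons.prems by auto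
    then have "length (y # xs) = length (filter (\<lambda>z. x < z) (y # xs))" using True by simp
    then show ?thesis using True by (intro Cons.prems(1)[of "[]" "y # xs"]) auto
  next
    case False
    obtain us vs where "xs = us @ vs" "insort x xs = us @ x # vs" "length vs = length (filter (\<lambda>y. x < y) xs)"
      using Cons.IH Cons.prems by auto
    then show ?thesis using False Cons.prems by (intro Cons.prems(1)[of "y # us" vs]) auto
  qed
qed simp

lemma list_minor_insort:
  assumes "sorted xs" "(x :: nat) \<notin> set xs"
  shows "list_minor a (insort x xs @ zs) =
    (-1) ^ (length (filter (\<lambda>y. x < y) xs) + length zs) * list_minor a (xs @ zs @ [x])"
proof -
  obtain us vs where *: "xs = us @ vs" "insort x xs = us @ x # vs" "length vs = length (filter (\<lambda>y. x < y) xs)"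
    using insort_split[OF assms] .
  have "list_minor a (insort x xs @ zs) = list_minor a (us @ x # (vs @ zs))"
    by (simp add: *(2))
  also have "\<dots> = (-1) ^ length (vs @ zs) * list_minor a (us @ (vs @ zs) @ [x])"
    by (rule list_minor_rotate)
  finally show ?thesis using * by simp
qed

text \<open>
  A unit vector as last row removes the last row and column. This is how a minor of size
  \<open>k + 1\<close> and one of size \<open>k + 2\<close> become values of the same bilinear form.
\<close>

lemma bordered_last_unit:
  "bordered (length xs) (\<lambda>i. a (xs ! i)) (a y) (\<lambda>j. if j = Suc (length xs) then 1 else 0)
    = list_minor a (xs @ [y])"
proof -
  let ?k = "length xs" and ?e = "\<lambda>j. if j = Suc (length xs) then 1 else (0::real)"
  let ?M = "mat (Suc ?k) (Suc ?k) (\<lambda>(i, j). a ((xs @ [y]) ! i) j)"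
  have "mat (Suc (Suc ?k)) (Suc (Suc ?k)) (\<lambda>(i, j). (if i < ?k then a (xs ! i) else if i = ?k then a y else ?e) j)
     = four_block_mat ?M (mat (Suc ?k) 1 (\<lambda>(i, j). a ((xs @ [y]) ! i) (Suc ?k))) (0\<^sub>m 1 (Suc ?k)) (1\<^sub>m 1)"
    by (intro eq_matI) (auto simp: nth_append elim!: less_SucE)
  then have "bordered ?k (\<lambda>i. a (xs ! i)) (a y) ?e = det ?M * det (1\<^sub>m 1)"
    unfolding bordered_def det_fun_def by (simp only:) (rule det_four_block_mat_lower_left_zero, auto)
  then show ?thesis by (simp add: list_minor_def det_fun_def)
qed

lemma bordered_two_rows:
  "bordered (length xs) (\<lambda>i. a (xs ! i)) (a y) (a z) = list_minor a (xs @ [y, z])"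
  unfolding bordered_def list_minor_def length_append list.size
  by (auto intro!: det_fun_cong simp: nth_append nth_Cons' less_Suc_eq)

text \<open>
  With the rows \<open>x\<close>, \<open>y\<close>, \<open>z\<close> and a unit vector this is \<open>Grassmann_Plucker\<close>. Sorting the
  rows into place produces the sign \<open>(-1) ^ (s x + s y + s z)\<close> in each of the three products, where
  \<open>s v\<close> counts the elements of \<open>J\<close> above \<open>v\<close>.
\<close>

lemma plucker_relations_flag_minor: "plucker_relations l u (flag_minor a)"
  unfolding plucker_relations_def
proof (intro allI impI)
  fix J x y z
  assume *: "J \<subseteq> {l..<u}" "x < y" "y < z" "x \<notin> J" "y \<notin> J" "z \<notin> J"
  then have fin: "finite J" using finite_subset by blast
  define xs where "xs = sorted_list_of_set J"
  have xs: "sorted xs" "set xs = J" using fin by (auto simp: xs_def)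
  define s where "s v = length (filter (\<lambda>y. v < y) xs)" for v
  have one: "flag_minor a (insert v J) = (-1) ^ s v * list_minor a (xs @ [v])" if "v \<notin> J" for v
    using list_minor_insort[of xs v a "[]"] that fin xs
    by (simp add: flag_minor_eq_list_minor s_def xs_def)
  have two: "flag_minor a (insert v (insert w J)) = (-1) ^ (s v + s w) * list_minor a (xs @ [v, w])"
    if "v < w" "v \<notin> J" "w \<notin> J" for v w
  proof -
    have sl: "sorted_list_of_set (insert v (insert w J)) = insort v (insort w xs)"
      using that fin by (simp add: xs_def)
    have f: "filter (\<lambda>y. v < y) (insort w xs) = insort w (filter (\<lambda>y. v < y) xs)"
      using filter_insort[where f = "\<lambda>x. x" and P = "\<lambda>y. v < y" and x = w and xs = xs] that xs by simp
    have "list_minor a (insort v (insort w xs) @ []) = (-1) ^ (Suc (s v)) * list_minor a (insort w xs @ [v])"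
      using list_minor_insort[of "insort w xs" v a "[]"] that xs
      by (simp add: sorted_insort set_insort_key f s_def)
    also have "list_minor a (insort w xs @ [v]) = (-1) ^ (Suc (s w)) * list_minor a (xs @ [v, w])"
      using list_minor_insort[of xs w a "[v]"] that xs by (simp add: s_def)
    finally show ?thesis
      using fin by (simp add: flag_minor_eq_list_minor sl power_add)
  qed
  let ?B = "bordered (length xs) (\<lambda>i. a (xs ! i))"
  let ?e = "\<lambda>j. if j = Suc (length xs) then 1 else (0::real)"
  have "?B (a x) (a y) * ?B (a z) ?e - ?B (a x) (a z) * ?B (a y) ?e + ?B (a x) ?e * ?B (a y) (a z) = 0"
    by (rule Grassmann_Plucker)
  then have "list_minor a (xs @ [y]) * list_minor a (xs @ [x, z]) =
      list_minor a (xs @ [x]) * list_minor a (xs @ [y, z]) + list_minor a (xs @ [z]) * list_minor a (xs @ [x, y])"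
    unfolding bordered_last_unit bordered_two_rows by (simp add: algebra_simps)
  then have "(-1) ^ (s x + s y + s z) * (list_minor a (xs @ [y]) * list_minor a (xs @ [x, z])) =
      (-1) ^ (s x + s y + s z) * (list_minor a (xs @ [x]) * list_minor a (xs @ [y, z])
        + list_minor a (xs @ [z]) * list_minor a (xs @ [x, y]))"
    by simp
  then show "flag_minor a (insert y J) * flag_minor a (insert x (insert z J)) =
      flag_minor a (insert x J) * flag_minor a (insert y (insert z J)) +
      flag_minor a (insert z J) * flag_minor a (insert x (insert y J))"
    using * by (simp add: one two power_add algebra_simps)
qed

section \<open>Expansion of the Wronskian\<close>

lemma newton_basis_change:
  fixes c d :: "nat \<Rightarrow> 'a :: comm_ring_1"
  obtains U where "\<And>m. U m m = 1" "\<And>l m. m < l \<Longrightarrow> U l m = 0"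
    "\<And>m y. (\<Prod>r<m. y - c r) = (\<Sum>l\<le>m. (\<Prod>r<l. y - d r) * U l m)"
proof -
  have "\<exists>u. u m = 1 \<and> (\<forall>l>m. u l = 0) \<and> (\<forall>y. (\<Prod>r<m. y - c r) = (\<Sum>l\<le>m. (\<Prod>r<l. y - d r) * u l))" for m
  proof (induction m)
    case 0
    show ?case by (rule exI[of _ "\<lambda>l. if l = 0 then 1 else 0"]) auto
  next
    case (Suc m)
    then obtain u where u: "u m = 1" "\<And>l. l > m \<Longrightarrow> u l = 0"
      "\<And>y. (\<Prod>r<m. y - c r) = (\<Sum>l\<le>m. (\<Prod>r<l. y - d r) * u l)" by blast
    let ?u = "\<lambda>l. (case l of 0 \<Rightarrow> 0 | Suc l' \<Rightarrow> u l') + (d l - c m) * u l"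
    have "(\<Prod>r<Suc m. y - c r) = (\<Sum>l\<le>Suc m. (\<Prod>r<l. y - d r) * ?u l)" for y
    proof -
      let ?N = "\<lambda>l. \<Prod>r<l. y - d r"
      have "(\<Prod>r<Suc m. y - c r) = (\<Sum>l\<le>m. (y - c m) * (?N l * u l))"
        by (simp add: u(3) mult.commute sum_distrib_left)
      also have "\<dots> = (\<Sum>l\<le>m. ?N (Suc l) * u l) + (\<Sum>l\<le>m. ?N l * ((d l - c m) * u l))"
        unfolding sum.distrib[symmetric] by (intro sum.cong) (auto simp: algebra_simps)
      also have "(\<Sum>l\<le>m. ?N l * ((d l - c m) * u l)) = (\<Sum>l\<le>Suc m. ?N l * ((d l - c m) * u l))"
        by (simp add: u(2))
      also have "(\<Sum>l\<le>m. ?N (Suc l) * u l) = (\<Sum>l\<le>Suc m. ?N l * (case l of 0 \<Rightarrow> 0 | Suc l' \<Rightarrow> u l'))"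
        by (subst sum.atMost_Suc_shift) simp
      finally show ?thesis by (simp only: sum.distrib distrib_left)
    qed
    then show ?case using u(1,2) by (intro exI[of _ ?u]) (auto split: nat.split)
  qed
  then obtain u where "\<And>m. u m m = 1 \<and> (\<forall>l>m. u m l = 0) \<and>
      (\<forall>y. (\<Prod>r<m. y - c r) = (\<Sum>l\<le>m. (\<Prod>r<l. y - d r) * u m l))" by metis
  then show ?thesis by (intro that[of "\<lambda>l m. u m l"]) blast+
qed

text \<open>
  The Newton bases for the nodes \<open>c\<close> and for the nodes \<open>y\<close> differ by a unitriangular matrix,
  and in the Newton basis with nodes \<open>y\<close> the matrix of values at \<open>y\<close> is triangular.
\<close>

lemma det_newton:
  fixes c y :: "nat \<Rightarrow> 'a :: comm_ring_1"
  shows "det_fun k (\<lambda>p m. \<Prod>r<m. y p - c r) = (\<Prod>p<k. \<Prod>r<p. y p - y r)"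
proof -
  obtain U where U: "\<And>m. U m m = 1" "\<And>l m. m < l \<Longrightarrow> U l m = 0"
    "\<And>m x. (\<Prod>r<m. x - c r) = (\<Sum>l\<le>m. (\<Prod>r<l. x - y r) * U l m)"
    using newton_basis_change[of c y] by blast
  have "det_fun k (\<lambda>p m. \<Prod>r<m. y p - c r) = det_fun k (\<lambda>p m. \<Sum>l<k. (\<Prod>r<l. y p - y r) * U l m)"
  proof (rule det_fun_cong)
    fix p m assume "m < k"
    show "(\<Prod>r<m. y p - c r) = (\<Sum>l<k. (\<Prod>r<l. y p - y r) * U l m)"
      unfolding U(3) by (rule sum.mono_neutral_left) (use \<open>m < k\<close> U(2) in auto)
  qed
  also have "\<dots> = det_fun k (\<lambda>p l. \<Prod>r<l. y p - y r) * det_fun k U" by (rule det_fun_mult)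
  also have "det_fun k U = 1" by (subst det_fun_upper_triangular) (auto simp: U)
  also have "det_fun k (\<lambda>p l. \<Prod>r<l. y p - y r) = (\<Prod>p<k. \<Prod>r<p. y p - y r)"
    by (rule det_fun_lower_triangular) (rule prod_zero, auto)
  finally show ?thesis by simp
qed

definition vandermonde :: "nat set \<Rightarrow> real" where
  "vandermonde I = (\<Prod>p<card I. \<Prod>r<p. real (pick I p) - real (pick I r))"

lemma vandermonde_pos: "vandermonde I > 0"
  unfolding vandermonde_def by (intro prod_pos) (auto intro!: pick_strict_mono)

text \<open>
  The size of the partition that corresponds to \<open>I\<close>: the exponent of \<open>x\<close> that belongs to \<open>I\<close> in the
  Wronskian.
\<close>

definition excess :: "nat set \<Rightarrow> nat" where
  "excess I = (\<Sum>p<card I. pick I p - p)"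

lemma pick_gap: "p \<le> q \<Longrightarrow> q < card I \<Longrightarrow> pick I p + (q - p) \<le> pick I q"
proof (induction q rule: dec_induct)
  case (step q)
  then show ?case using pick_strict_mono[of q "Suc q" I] by simp
qed simp

lemma pick_ge: "p < card I \<Longrightarrow> p \<le> pick I p"
  using pick_gap[of 0 p I] by simp

lemma pick_le_end:
  assumes "I \<in> rows_of_size n k" "p < k"
  shows "pick I p \<le> n - k + p" "k \<le> n"
proof -
  have "pick I p + (k - 1 - p) \<le> pick I (k - 1)" using assms by (intro pick_gap) auto
  also have "pick I (k - 1) < n" using assms by (intro pick_less[of I]) auto
  finally show "pick I p \<le> n - k + p" using assms(2) by linarith
  show "k \<le> n" using assms(1) card_mono[of "{..<n}" I] by auto
qed

lemma rows_eq_pick: "I \<in> rows_of_size n k \<Longrightarrow> I = pick I ` {..<k}"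
  using bij_betw_imp_surj_on[OF bij_betw_pick[of I]] finite_subset[of I "{..<n}"] by auto

lemma excess_eq_0:
  assumes "I \<in> rows_of_size n k" "excess I = 0"
  shows "I = {..<k}"
proof -
  have "pick I p = p" if "p < k" for p
    using that assms by (intro antisym pick_ge) (auto simp: excess_def)
  then have "pick I ` {..<k} = {..<k}" by auto
  then show ?thesis using rows_eq_pick[OF assms(1)] by simp
qed

lemma excess_le:
  assumes "I \<in> rows_of_size n k"
  shows "excess I \<le> k * (n - k)"
proof -
  have "(\<Sum>p<k. pick I p - p) \<le> of_nat (card {..<k}) * (n - k)"
  proof (rule sum_bounded_above)
    show "pick I p - p \<le> n - k" if "p \<in> {..<k}" for p
      using pick_le_end(1)[OF assms, of p] that by simp
  qed
  then show ?thesis using assms by (simp add: excess_def)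
qed

lemma excess_eq_max:
  assumes "I \<in> rows_of_size n k" "excess I = k * (n - k)"
  shows "I = {n - k..<n}"
proof (cases "k = 0")
  case True
  then show ?thesis using assms(1) finite_subset[of I "{..<n}"] by auto
next
  case False
  then have "k \<le> n" using pick_le_end(2)[OF assms(1), of 0] by simp
  have eq: "pick I p = n - k + p" if "p < k" for p
  proof (rule ccontr)
    assume "pick I p \<noteq> n - k + p"
    then have "pick I p - p < n - k" using pick_le_end(1)[OF assms(1) that] pick_ge[of p I] assms that by auto
    then have "(\<Sum>p<k. pick I p - p) < (\<Sum>p<k. n - k)"
      using pick_le_end(1)[OF assms(1)] that
      by (intro sum_strict_mono_ex1 bexI[of _ p]) (simp_all add: le_diff_conv)
    then show False using assms by (simp add: excess_def)
  qed
  have "I = pick I ` {..<k}" by (rule rows_eq_pick[OF assms(1)])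
  also have "\<dots> = (+) (n - k) ` {0..<k}" using eq by (intro image_cong) auto
  also have "\<dots> = {n - k..<n}" unfolding image_add_atLeastLessThan using \<open>k \<le> n\<close> by simp
  finally show ?thesis .
qed

lemma rows_first: "k \<le> n \<Longrightarrow> {..<k} \<in> rows_of_size n k"
  and rows_last: "k \<le> n \<Longrightarrow> {n - k..<n} \<in> rows_of_size n k"
  by auto

lemma pick_first: "p < k \<Longrightarrow> pick {..<k} p = p"
  using pick_le_end(1)[of "{..<k}" k k p] pick_ge[of p "{..<k}"] by simp

lemma excess_first: "excess {..<k} = 0"
  by (simp add: excess_def pick_first)

lemma pick_last:
  assumes "k \<le> n" "p < k"
  shows "pick {n - k..<n} p = n - k + p"
proof -
  have "pick {n - k..<n} 0 \<in> {n - k..<n}" by (rule pick_in_set_le) (use assms in auto)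
  then show ?thesis
    using pick_gap[of 0 p "{n - k..<n}"] pick_le_end(1)[OF rows_last[OF assms(1)] assms(2)] assms
    by auto
qed

lemma excess_last: "k \<le> n \<Longrightarrow> excess {n - k..<n} = k * (n - k)"
  by (simp add: excess_def pick_last)

lemma higher_pderiv_unit_monom:
  "(pderiv ^^ i) (monom 1 m) = monom (\<Prod>r<i. real m - real r) (m - i)"
proof (induction i)
  case (Suc i)
  have "real (m - i) * (\<Prod>r<i. real m - real r) = (real m - real i) * (\<Prod>r<i. real m - real r)"
    by (cases "i \<le> m") (auto simp: of_nat_diff)
  with Suc show ?case by (simp add: pderiv_monom mult.commute)
qed simp

lemma det_fun_const_poly: "det_fun k (\<lambda>i j. [:a i j:]) = [:det_fun k a:]"
proof -
  interpret comm_ring_hom "\<lambda>c :: 'a. [:c:]" by unfold_locales auto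
  have "mat k k (\<lambda>(i, j). [:a i j:]) = map_mat (\<lambda>c. [:c:]) (mat k k (\<lambda>(i, j). a i j))"
    by (intro eq_matI) auto
  then show ?thesis by (simp add: det_fun_def)
qed

lemma prod_monom: "finite A \<Longrightarrow> (\<Prod>x\<in>A. monom 1 (e x)) = monom (1 :: 'a :: comm_semiring_1) (\<Sum>x\<in>A. e x)"
  by (induction rule: finite_induct) (auto simp: mult_monom)

text \<open>
  Multiplying row \<open>i\<close> by \<open>x ^ i\<close> turns the entry in column \<open>p\<close> into a falling factorial of
  \<open>pick I p\<close> times \<open>x ^ pick I p\<close>. The powers of \<open>x\<close> leave the columns, and falling
  factorials form a Newton basis, so \<open>det_newton\<close> applies.
\<close>

lemma wronskian_monomials:
  assumes "card I = k"
  shows "det_fun k (\<lambda>i p. (pderiv ^^ i) (monom 1 (pick I p))) = monom (vandermonde I) (excess I)"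
proof -
  let ?m = "pick I" and ?c = "\<lambda>i m. \<Prod>r<i. real m - real r"
  let ?W = "det_fun k (\<lambda>i p. (pderiv ^^ i) (monom 1 (?m p)))"
  have "(\<Prod>i<k. monom 1 i) * ?W = det_fun k (\<lambda>i p. monom 1 i * (pderiv ^^ i) (monom 1 (?m p)))"
    by (rule det_fun_scale_rows[symmetric])
  also have "\<dots> = det_fun k (\<lambda>i p. monom 1 (?m p) * [:?c i (?m p):])"
  proof (rule det_fun_cong)
    fix i p
    show "monom 1 i * (pderiv ^^ i) (monom 1 (?m p)) = monom 1 (?m p) * [:?c i (?m p):]"
    proof (cases "i \<le> ?m p")
      case True
      then show ?thesis by (simp add: higher_pderiv_unit_monom mult_monom smult_monom)
    next
      case False
      then have c: "?c i (?m p) = 0" by (auto intro!: prod_zero bexI[of _ "?m p"])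
      show ?thesis unfolding higher_pderiv_unit_monom c by simp
    qed
  qed
  also have "\<dots> = (\<Prod>p<k. monom 1 (?m p)) * det_fun k (\<lambda>i p. [:?c i (?m p):])"
    by (rule det_fun_scale_cols)
  also have "det_fun k (\<lambda>i p. [:?c i (?m p):]) = [:vandermonde I:]"
    unfolding det_fun_const_poly vandermonde_def assms
    by (subst det_fun_transpose[symmetric]) (subst det_newton, rule refl)
  also have "(\<Prod>p<k. monom 1 (?m p)) = (\<Prod>i<k. monom (1::real) i) * monom 1 (excess I)"
  proof -
    have "(\<Sum>p<k. ?m p) = (\<Sum>p<k. p) + excess I"
      unfolding excess_def assms sum.distrib[symmetric]
      by (intro sum.cong) (use pick_ge[of _ I] assms in auto)
    then show ?thesis by (simp add: prod_monom mult_monom)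
  qed
  finally have "(\<Prod>i<k. monom 1 i) * ?W = (\<Prod>i<k. monom 1 i) * monom (vandermonde I) (excess I)"
    using smult_monom[of "vandermonde I" 1 "excess I", symmetric] by (simp add: mult.assoc)
  moreover have "(\<Prod>i<k. monom (1::real) i) \<noteq> 0" by (simp add: prod_monom)
  ultimately show ?thesis by simp
qed

lemma wronskian_expansion:
  assumes "\<And>j. j < k \<Longrightarrow> degree (f j) < n"
  shows "wronskian (map f [0..<k]) =
    (\<Sum>I\<in>rows_of_size n k. monom (flag_minor (\<lambda>i j. coeff (f j) i) I * vandermonde I) (excess I))"
proof -
  have "wronskian (map f [0..<k]) = det_fun k (\<lambda>i j. (pderiv ^^ i) (f j))"
    unfolding wronskian_def det_fun_def
    by (auto intro!: arg_cong[where f = det] eq_matI)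
  also have "\<dots> = det_fun k (\<lambda>i j. \<Sum>m<n. (pderiv ^^ i) (monom 1 m) * [:coeff (f j) m:])"
  proof (rule det_fun_cong)
    fix i j assume "j < k"
    have "f j = (\<Sum>m\<le>n - 1. monom (coeff (f j) m) m)"
      using assms[OF \<open>j < k\<close>] by (intro poly_as_sum_of_monoms'[symmetric]) auto
    also have "\<dots> = (\<Sum>m<n. Polynomial.smult (coeff (f j) m) (monom 1 m))"
      using assms[OF \<open>j < k\<close>] by (intro sum.cong) (auto simp: smult_monom)
    finally have "(pderiv ^^ i) (f j) = (pderiv ^^ i) (\<Sum>m<n. Polynomial.smult (coeff (f j) m) (monom 1 m))"
      by simp
    then show "(pderiv ^^ i) (f j) = (\<Sum>m<n. (pderiv ^^ i) (monom 1 m) * [:coeff (f j) m:])"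
      by (simp add: higher_pderiv_sum higher_pderiv_smult)
  qed
  also have "\<dots> = (\<Sum>I\<in>rows_of_size n k. det_fun k (\<lambda>i p. (pderiv ^^ i) (monom 1 (pick I p)))
      * det_fun k (\<lambda>p j. [:coeff (f j) (pick I p):]))"
    by (rule Cauchy_Binet)
  also have "\<dots> = (\<Sum>I\<in>rows_of_size n k. monom (flag_minor (\<lambda>i j. coeff (f j) i) I * vandermonde I) (excess I))"
    by (intro sum.cong)
      (auto simp: wronskian_monomials det_fun_const_poly flag_minor_def smult_monom)
  finally show ?thesis .
qed

section \<open>Pulling back along a Moebius substitution\<close>

definition poly_minor :: "(nat \<Rightarrow> real poly) \<Rightarrow> nat set \<Rightarrow> real" where
  "poly_minor f = flag_minor (\<lambda>i j. coeff (f j) i)"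

text \<open>
  The coefficient of \<open>(y - x) ^ m\<close> in the Taylor expansion of \<open>f y\<close> at \<open>x\<close>.
\<close>

definition taylor :: "real poly \<Rightarrow> real \<Rightarrow> nat \<Rightarrow> real" where
  "taylor f x m = coeff (f \<circ>\<^sub>p [:x, 1:]) m"

lemma poly_higher_pderiv_eq_taylor: "poly ((pderiv ^^ m) f) x = fact m * taylor f x m"
proof -
  have shift: "(pderiv ^^ m) f \<circ>\<^sub>p [:x, 1:] = (pderiv ^^ m) (f \<circ>\<^sub>p [:x, 1:])"
  proof (induction m)
    case (Suc m)
    then show ?case
      using pderiv_pcompose[of "(pderiv ^^ m) f" "[:x, 1:]"] by (simp add: pderiv_pCons)
  qed simp
  have "poly ((pderiv ^^ m) f) x = poly ((pderiv ^^ m) f \<circ>\<^sub>p [:x, 1:]) 0"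
    by (simp add: poly_pcompose)
  also have "\<dots> = coeff ((pderiv ^^ m) (f \<circ>\<^sub>p [:x, 1:])) 0"
    unfolding shift by (simp add: poly_0_coeff_0)
  also have "\<dots> = fact m * taylor f x m"
    by (simp add: coeff_higher_pderiv taylor_def pochhammer_fact)
  finally show ?thesis .
qed

lemma poly_wronskian_eq_taylor:
  "poly (wronskian (map f [0..<k])) x = (\<Prod>i<k. fact i) * det_fun k (\<lambda>i j. taylor (f j) x i)"
proof -
  interpret comm_ring_hom "\<lambda>p. poly p x" by unfold_locales auto
  have "poly (wronskian (map f [0..<k])) x
      = det (map_mat (\<lambda>p. poly p x) (mat k k (\<lambda>(i, j). (pderiv ^^ i) (f j))))"
    unfolding hom_det wronskian_def by (auto intro!: arg_cong[where f = det] arg_cong[where f = "\<lambda>p. poly p x"] eq_matI)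
  also have "\<dots> = det_fun k (\<lambda>i j. fact i * taylor (f j) x i)"
    unfolding det_fun_def
    by (intro arg_cong[where f = det] eq_matI) (auto simp: poly_higher_pderiv_eq_taylor)
  finally show ?thesis by (simp add: det_fun_scale_rows)
qed

lemma poly_eq_taylor_sum:
  assumes "degree f \<le> N"
  shows "poly f x = (\<Sum>m\<le>N. taylor f c m * (x - c) ^ m)"
proof -
  have "poly f x = poly (f \<circ>\<^sub>p [:c, 1:]) (x - c)" by (simp add: poly_pcompose)
  also have "\<dots> = (\<Sum>m\<le>degree (f \<circ>\<^sub>p [:c, 1:]). taylor f c m * (x - c) ^ m)"
    unfolding taylor_def by (rule poly_altdef)
  also have "\<dots> = (\<Sum>m\<le>N. taylor f c m * (x - c) ^ m)"
    using assms by (intro sum.mono_neutral_left) (auto simp: taylor_def degree_pcompose intro: coeff_eq_0)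
  finally show ?thesis .
qed

text \<open>
  For \<open>degree f \<le> N\<close> this is the polynomial \<open>(1 + d * x) ^ N * f ((a + x) / (1 + d * x))\<close>.
  For \<open>0 < a < 1 / d\<close> it turns the behaviour of \<open>f\<close> on \<open>[a, 1 / d]\<close> into behaviour on \<open>[0, \<infinity>]\<close>.
\<close>

definition moebius :: "nat \<Rightarrow> real \<Rightarrow> real \<Rightarrow> real poly \<Rightarrow> real poly" where
  "moebius N a d f = (\<Sum>m\<le>N. Polynomial.smult (coeff f m) ([:a, 1:] ^ m * [:1, d:] ^ (N - m)))"

text \<open>
  Both sides are the homogeneous form of degree \<open>N\<close> of \<open>f\<close> at \<open>(x, y)\<close>; the right-hand side
  does not depend on the centre \<open>c\<close> of the expansion.
\<close>

lemma poly_homogenize: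
  assumes "y \<noteq> 0" "degree f \<le> N"
  shows "(\<Sum>m\<le>N. taylor f c m * ((x - c * y) ^ m * y ^ (N - m))) = y ^ N * poly f (x / y)"
proof -
  have *: "y ^ N * (taylor f c m * (x / y - c) ^ m) = taylor f c m * ((x - c * y) ^ m * y ^ (N - m))"
    if "m \<le> N" for m
  proof -
    have "x / y - c = (x - c * y) / y" using assms by (simp add: field_simps)
    then show ?thesis using assms that by (simp add: power_divide power_diff)
  qed
  show ?thesis
    unfolding poly_eq_taylor_sum[OF assms(2), of "x / y" c] sum_distrib_left
    by (intro sum.cong refl *[symmetric]) simp
qed

lemma poly_eqI_cofinite:
  fixes p q :: "real poly"
  assumes "finite A" "\<And>x. x \<notin> A \<Longrightarrow> poly p x = poly q x"
  shows "p = q"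
proof (rule ccontr)
  assume "p \<noteq> q"
  then have "finite {x. poly (p - q) x = 0}" by (intro poly_roots_finite) auto
  with assms(1) have "finite (A \<union> {x. poly (p - q) x = 0})" by simp
  moreover have "A \<union> {x. poly (p - q) x = 0} = UNIV" using assms(2) by auto
  ultimately show False using infinite_UNIV_char_0 by metis
qed

text \<open>
  The Taylor expansion of \<open>f\<close> may be taken at any \<open>c\<close>. The choices \<open>c = 1 / d\<close> and \<open>c = a\<close> make
  the first factor a constant and a multiple of \<open>x\<close>, respectively.
\<close>

lemma moebius_expand:
  assumes "degree f \<le> N"
  shows "moebius N a d f =
    (\<Sum>m\<le>N. Polynomial.smult (taylor f c m) ([:a - c, 1 - c * d:] ^ m * [:1, d:] ^ (N - m)))"
proof (rule poly_eqI_cofinite)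
  show "finite {x. poly [:1, d:] x = 0}" by (rule poly_roots_finite) simp
  fix x assume "x \<notin> {x. poly [:1, d:] x = 0}"
  then have y: "1 + d * x \<noteq> 0" by (simp add: mult.commute)
  have "poly (moebius N a d f) x = (\<Sum>m\<le>N. taylor f 0 m * ((a + x - 0 * (1 + d * x)) ^ m * (1 + d * x) ^ (N - m)))"
    by (simp add: moebius_def poly_sum taylor_def mult.commute)
  also have "\<dots> = (\<Sum>m\<le>N. taylor f c m * ((a + x - c * (1 + d * x)) ^ m * (1 + d * x) ^ (N - m)))"
    unfolding poly_homogenize[OF y assms] ..
  also have "\<dots> = poly (\<Sum>m\<le>N. Polynomial.smult (taylor f c m) ([:a - c, 1 - c * d:] ^ m * [:1, d:] ^ (N - m))) x"
    by (simp add: poly_sum algebra_simps)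
  finally show "poly (moebius N a d f) x = poly (\<Sum>m\<le>N. Polynomial.smult (taylor f c m) ([:a - c, 1 - c * d:] ^ m * [:1, d:] ^ (N - m))) x" .
qed

lemma coeff_unit_binomial_power: "coeff ([:1, d:] ^ n) i = real (n choose i) * d ^ i"
proof (cases "i \<le> n")
  case True
  then show ?thesis by (simp add: coeff_linear_poly_power)
next
  case False
  have "degree ([:1, d:] ^ n) \<le> n" by (rule order.trans[OF degree_power_le]) simp
  with False have "degree ([:1, d:] ^ n) < i" by simp
  then show ?thesis using False by (simp add: coeff_eq_0)
qed

lemma coeff_moebius_end:
  assumes "degree f \<le> N" "b * d = 1"
  shows "coeff (moebius N a d f) i =
    (\<Sum>m<Suc N. (real (N - m choose i) * d ^ i) * ((a - b) ^ m * taylor f b m))"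
proof -
  have "[:a - b, 1 - b * d:] ^ m = [:(a - b) ^ m:]" for m
    using assms(2) by (simp add: poly_const_pow)
  then have "coeff (moebius N a d f) i = (\<Sum>m\<le>N. taylor f b m * ((a - b) ^ m * coeff ([:1, d:] ^ (N - m)) i))"
    unfolding moebius_expand[OF assms(1), of a d b] by (simp add: coeff_sum mult.assoc)
  also have "\<dots> = (\<Sum>m<Suc N. (real (N - m choose i) * d ^ i) * ((a - b) ^ m * taylor f b m))"
    unfolding lessThan_Suc_atMost
    by (intro sum.cong) (auto simp: coeff_unit_binomial_power mult_ac)
  finally show ?thesis .
qed

lemma coeff_moebius_start:
  assumes "degree f \<le> N"
  shows "coeff (moebius N a d f) i =
    (\<Sum>m<Suc N. coeff (monom 1 m * [:1, d:] ^ (N - m)) i * ((1 - a * d) ^ m * taylor f a m))"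
proof -
  have "[:a - a, 1 - a * d:] ^ m = Polynomial.smult ((1 - a * d) ^ m) (monom 1 m)" for m
    using monom_power[of "1 - a * d" 1 m] by (simp add: monom_Suc monom_0 smult_monom)
  then have "coeff (moebius N a d f) i
     = (\<Sum>m\<le>N. taylor f a m * ((1 - a * d) ^ m * coeff (monom 1 m * [:1, d:] ^ (N - m)) i))"
    unfolding moebius_expand[OF assms, of a d a] by (simp add: coeff_sum mult.assoc)
  also have "\<dots> = (\<Sum>m<Suc N. coeff (monom 1 m * [:1, d:] ^ (N - m)) i * ((1 - a * d) ^ m * taylor f a m))"
    unfolding lessThan_Suc_atMost by (intro sum.cong) (auto simp: mult_ac)
  finally show ?thesis .
qed

text \<open>
  Up to factors that depend on \<open>i\<close> alone or on \<open>m\<close> alone, the coefficients of \<open>(1 + x) ^ (N - m)\<close> are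
  values of a Newton basis with nodes \<open>N, N - 1, \<dots>\<close>.
\<close>

lemma binomial_diff_eq_newton:
  assumes "m \<le> N" "i \<le> N"
  shows "real (N - m choose i) =
    real (N choose i) * ((-1) ^ m / (\<Prod>r<m. real (N - r)) * (\<Prod>r<m. real i - real (N - r)))"
  using assms(1)
proof (induction m)
  case (Suc m)
  have "(N - m - i) * (N - m choose i) = (N - m) * ((N - m - 1) choose i)"
    by (rule binomial_absorb_comp)
  then have "real (N - m - i) * real (N - m choose i) = real (N - m) * real (N - Suc m choose i)"
    by (simp add: of_nat_mult[symmetric] del: of_nat_mult)
  moreover have "real (N - m - i) * real (N - m choose i) = (real (N - m) - real i) * real (N - m choose i)"
    by (cases "i \<le> N - m") (auto simp: of_nat_diff)
  ultimately have step: "real (N - Suc m choose i) = (real (N - m) - real i) / real (N - m) * real (N - m choose i)"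
    using Suc.prems by (simp add: field_simps)
  have IH: "real (N - m choose i) =
      real (N choose i) * ((-1) ^ m / (\<Prod>r<m. real (N - r)) * (\<Prod>r<m. real i - real (N - r)))"
    using Suc by simp
  have rearrange: "(A - x) / A * (C * (s / Q * P)) = C * ((-1 * s) / (Q * A) * (P * (x - A)))"
    for A C P Q s x :: real by (simp add: divide_inverse algebra_simps)
  show ?case unfolding step IH rearrange by simp
qed simp

text \<open>
  The minors of the coefficient matrix of the powers \<open>[:1, d:] ^ (N - m)\<close>. For \<open>m < k\<close> these powers
  span the \<open>k\<close>-th step of the flag that is reached for \<open>a = 1 / d\<close>.
\<close>

definition endpoint_minor :: "nat \<Rightarrow> real \<Rightarrow> nat set \<Rightarrow> nat set \<Rightarrow> real" where
  "endpoint_minor N d I S = det_fun (card I) (\<lambda>p q. real (N - pick S q choose pick I p) * d ^ pick I p)"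

definition endpoint_sign :: "nat \<Rightarrow> nat \<Rightarrow> real" where
  "endpoint_sign N k = (\<Prod>m<k. (-1) ^ m / (\<Prod>r<m. real (N - r)))"

lemma endpoint_sign_nonzero: "k \<le> Suc N \<Longrightarrow> endpoint_sign N k \<noteq> 0"
  by (auto simp: endpoint_sign_def)

text \<open>
  The limit flag is totally positive: its coordinates have a sign that depends on \<open>k\<close> only, because
  \<open>binomial_diff_eq_newton\<close> reduces them to Vandermonde determinants.
\<close>

lemma endpoint_minor_first:
  assumes "I \<in> rows_of_size (Suc N) k" "k \<le> Suc N" "d > 0"
  obtains c where "c > 0" "endpoint_minor N d I {..<k} = endpoint_sign N k * c"
proof -
  let ?w = "\<lambda>p. real (N choose pick I p) * d ^ pick I p"
  let ?e = "\<lambda>m. (-1) ^ m / (\<Prod>r<m. real (N - r))"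
  have le: "pick I p \<le> N" if "p < k" for p
    using pick_less[of I "Suc N" p] assms(1) that by auto
  have "endpoint_minor N d I {..<k} =
      det_fun k (\<lambda>p m. ?w p * (?e m * (\<Prod>r<m. real (pick I p) - real (N - r))))"
    unfolding endpoint_minor_def
  proof (rule trans[OF _ det_fun_cong])
    show "det_fun (card I) (\<lambda>p q. real (N - pick {..<k} q choose pick I p) * d ^ pick I p) =
      det_fun k (\<lambda>p q. real (N - pick {..<k} q choose pick I p) * d ^ pick I p)"
      using assms(1) by simp
    fix p m assume "p < k" "m < k"
    then show "real (N - pick {..<k} m choose pick I p) * d ^ pick I p =
        ?w p * (?e m * (\<Prod>r<m. real (pick I p) - real (N - r)))"
      using binomial_diff_eq_newton[of m N "pick I p"] le[of p] assms(2)
      by (simp only: pick_first) simp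
  qed
  also have "\<dots> = (\<Prod>p<k. ?w p) * (endpoint_sign N k * vandermonde I)"
    using assms(1) unfolding det_fun_scale_rows det_fun_scale_cols endpoint_sign_def vandermonde_def
    by (simp add: det_newton)
  finally have "endpoint_minor N d I {..<k} = endpoint_sign N k * ((\<Prod>p<k. ?w p) * vandermonde I)"
    by (simp only: mult_ac)
  moreover have "(\<Prod>p<k. ?w p) > 0" using le assms(3) by (intro prod_pos) auto
  then have "(\<Prod>p<k. ?w p) * vandermonde I > 0" by (intro mult_pos_pos vandermonde_pos)
  ultimately show ?thesis using that by blast
qed

text \<open>
  The minors of the pulled back polynomials, divided by the power of \<open>a - b\<close> that all minors of this
  size contain. They are polynomials in \<open>a\<close>, and at \<open>a = b\<close> only the term \<open>S = {..<card I}\<close> remains.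
\<close>

definition normalized_minor :: "nat \<Rightarrow> real \<Rightarrow> real \<Rightarrow> (nat \<Rightarrow> real poly) \<Rightarrow> nat set \<Rightarrow> real \<Rightarrow> real" where
  "normalized_minor N b d f I a = (\<Sum>S\<in>rows_of_size (Suc N) (card I).
     endpoint_minor N d I S * det_fun (card I) (\<lambda>q j. taylor (f j) b (pick S q)) * (a - b) ^ excess S)"

lemma poly_minor_moebius:
  assumes "\<And>j. degree (f j) \<le> N" "b * d = 1"
  shows "poly_minor (\<lambda>j. moebius N a d (f j)) I =
    (\<Prod>q<card I. (a - b) ^ q) * normalized_minor N b d f I a"
proof -
  let ?k = "card I"
  have "poly_minor (\<lambda>j. moebius N a d (f j)) I = det_fun ?k (\<lambda>p j. \<Sum>m<Suc N.
      (real (N - m choose pick I p) * d ^ pick I p) * ((a - b) ^ m * taylor (f j) b m))"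
    unfolding poly_minor_def flag_minor_def
    by (rule det_fun_cong) (simp only: coeff_moebius_end[OF assms(1,2)])
  also have "\<dots> = (\<Sum>S\<in>rows_of_size (Suc N) ?k. endpoint_minor N d I S *
      det_fun ?k (\<lambda>q j. (a - b) ^ pick S q * taylor (f j) b (pick S q)))"
    unfolding endpoint_minor_def by (rule Cauchy_Binet)
  also have "\<dots> = (\<Sum>S\<in>rows_of_size (Suc N) ?k. (\<Prod>q<?k. (a - b) ^ q) *
      (endpoint_minor N d I S * det_fun ?k (\<lambda>q j. taylor (f j) b (pick S q)) * (a - b) ^ excess S))"
  proof (rule sum.cong[OF refl])
    fix S assume S: "S \<in> rows_of_size (Suc N) ?k"
    have "(\<Prod>q<?k. (a - b) ^ pick S q) = (\<Prod>q<?k. (a - b) ^ q * (a - b) ^ (pick S q - q))"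
      unfolding power_add[symmetric] using S pick_ge[of _ S] by (intro prod.cong) auto
    then have "(\<Prod>q<?k. (a - b) ^ pick S q) = (\<Prod>q<?k. (a - b) ^ q) * (a - b) ^ excess S"
      using S by (simp add: prod.distrib power_sum excess_def)
    then show "endpoint_minor N d I S * det_fun ?k (\<lambda>q j. (a - b) ^ pick S q * taylor (f j) b (pick S q)) =
      (\<Prod>q<?k. (a - b) ^ q) * (endpoint_minor N d I S * det_fun ?k (\<lambda>q j. taylor (f j) b (pick S q)) * (a - b) ^ excess S)"
      unfolding det_fun_scale_rows by (simp add: mult_ac)
  qed
  finally show ?thesis by (simp only: normalized_minor_def sum_distrib_left)
qed

lemma normalized_minor_endpoint:
  assumes "card I \<le> Suc N"
  shows "normalized_minor N b d f I b = endpoint_minor N d I {..<card I} * det_fun (card I) (\<lambda>q j. taylor (f j) b q)"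
proof -
  let ?k = "card I"
  let ?t = "\<lambda>S. endpoint_minor N d I S * det_fun ?k (\<lambda>q j. taylor (f j) b (pick S q)) * (b - b) ^ excess S"
  have "normalized_minor N b d f I b = (\<Sum>S\<in>{{..<?k}}. ?t S)"
    unfolding normalized_minor_def
  proof (rule sum.mono_neutral_right)
    show "{{..<?k}} \<subseteq> rows_of_size (Suc N) ?k" using rows_first[OF assms] by auto
    show "\<forall>S\<in>rows_of_size (Suc N) ?k - {{..<?k}}. ?t S = 0"
      using excess_eq_0[of _ "Suc N" ?k] by auto
  qed (auto intro: finite_subset[of _ "Pow {..<Suc N}"])
  also have "\<dots> = ?t {..<?k}" by simp
  also have "det_fun ?k (\<lambda>q j. taylor (f j) b (pick {..<?k} q)) = det_fun ?k (\<lambda>q j. taylor (f j) b q)"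
    by (rule det_fun_cong) (simp add: pick_first)
  finally show ?thesis by (simp add: excess_first)
qed

text \<open>
  In the expansion at \<open>a\<close> the \<open>m\<close>-th summand is divisible by \<open>x ^ m\<close>, so the coefficients below
  \<open>x ^ k\<close> only involve the Taylor coefficients below order \<open>k\<close>, through a unitriangular matrix.
\<close>

lemma poly_minor_moebius_first:
  assumes "\<And>j. degree (f j) \<le> N" "k \<le> Suc N"
  shows "poly_minor (\<lambda>j. moebius N a d (f j)) {..<k} =
    (\<Prod>q<k. (1 - a * d) ^ q) * det_fun k (\<lambda>q j. taylor (f j) a q)"
proof -
  let ?L = "\<lambda>i m. coeff (monom 1 m * [:1, d:] ^ (N - m)) i"
  have L: "?L i m = 0" if "i < m" for i m using that by (simp add: coeff_monom_mult)
  have "poly_minor (\<lambda>j. moebius N a d (f j)) {..<k} =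
      det_fun k (\<lambda>i j. \<Sum>m<k. ?L i m * ((1 - a * d) ^ m * taylor (f j) a m))"
    unfolding poly_minor_def flag_minor_def card_lessThan
  proof (rule det_fun_cong)
    fix i j assume "i < k"
    then show "coeff (moebius N a d (f j)) (pick {..<k} i) = (\<Sum>m<k. ?L i m * ((1 - a * d) ^ m * taylor (f j) a m))"
      unfolding pick_first[OF \<open>i < k\<close>] coeff_moebius_start[OF assms(1)]
      by (intro sum.mono_neutral_right) (use assms(2) L in auto)
  qed
  also have "\<dots> = det_fun k ?L * det_fun k (\<lambda>m j. (1 - a * d) ^ m * taylor (f j) a m)"
    by (rule det_fun_mult)
  also have "det_fun k ?L = 1"
    by (subst det_fun_lower_triangular)
      (use L in \<open>auto simp: coeff_monom_mult coeff_unit_binomial_power\<close>)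
  finally show ?thesis by (simp add: det_fun_scale_rows)
qed

text \<open>
  In the expansion at \<open>b\<close> the \<open>m\<close>-th summand has degree at most \<open>N - m\<close>, so the \<open>k\<close> highest
  coefficients only involve the Taylor coefficients below order \<open>k\<close>.
\<close>

lemma poly_minor_moebius_last:
  assumes "\<And>j. degree (f j) \<le> N" "b * d = 1" "k \<le> Suc N"
  shows "poly_minor (\<lambda>j. moebius N a d (f j)) {Suc N - k..<Suc N} =
    endpoint_minor N d {Suc N - k..<Suc N} {..<k} * ((\<Prod>q<k. (a - b) ^ q) * det_fun k (\<lambda>q j. taylor (f j) b q))"
proof -
  let ?I = "{Suc N - k..<Suc N}"
  let ?K = "\<lambda>p m. real (N - m choose pick ?I p) * d ^ pick ?I p"
  have card: "card ?I = k" using assms(3) by simp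
  have "poly_minor (\<lambda>j. moebius N a d (f j)) ?I =
      det_fun k (\<lambda>p j. \<Sum>m<k. ?K p m * ((a - b) ^ m * taylor (f j) b m))"
    unfolding poly_minor_def flag_minor_def card
  proof (rule det_fun_cong)
    fix p j assume "p < k"
    then have "pick ?I p = Suc N - k + p" by (rule pick_last[OF assms(3)])
    then show "coeff (moebius N a d (f j)) (pick ?I p) = (\<Sum>m<k. ?K p m * ((a - b) ^ m * taylor (f j) b m))"
      unfolding coeff_moebius_end[OF assms(1,2)]
      by (intro sum.mono_neutral_right) (use assms(3) in auto)
  qed
  also have "\<dots> = det_fun k ?K * det_fun k (\<lambda>m j. (a - b) ^ m * taylor (f j) b m)"
    by (rule det_fun_mult)
  also have "det_fun k ?K = endpoint_minor N d ?I {..<k}"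
    unfolding endpoint_minor_def card by (rule det_fun_cong) (simp add: pick_first)
  finally show ?thesis by (simp add: det_fun_scale_rows)
qed

section \<open>Moving along a family of flags\<close>

lemma continuous_on_Min:
  fixes g :: "'i \<Rightarrow> real \<Rightarrow> real"
  assumes "finite F" "F \<noteq> {}" "\<And>I. I \<in> F \<Longrightarrow> continuous_on S (g I)"
  shows "continuous_on S (\<lambda>t. Min ((\<lambda>I. g I t) ` F))"
  using assms
proof (induction rule: finite_ne_induct)
  case (insert I F)
  then have "continuous_on S (\<lambda>t. min (g I t) (Min ((\<lambda>I. g I t) ` F)))"
    by (intro continuous_on_min) auto
  then show ?case using insert by (simp add: image_insert)
qed simp

text \<open>
  If the minimum of the functions were not positive at \<open>a\<close>, it would vanish somewhere on the way to \<open>b\<close>.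
  There all functions are nonnegative, hence positive by \<open>upgrade\<close>, a contradiction.
\<close>

lemma positive_along_path:
  fixes g :: "'i \<Rightarrow> real \<Rightarrow> real"
  assumes "finite F" "a \<le> b" and cont: "\<And>I. I \<in> F \<Longrightarrow> continuous_on {a..b} (g I)"
    and end_pos: "\<And>I. I \<in> F \<Longrightarrow> g I b > 0"
    and upgrade: "\<And>t I. a \<le> t \<Longrightarrow> t < b \<Longrightarrow> (\<And>J. J \<in> F \<Longrightarrow> g J t \<ge> 0) \<Longrightarrow> I \<in> F \<Longrightarrow> g I t > 0"
    and "I \<in> F"
  shows "g I a > 0"
proof (rule ccontr)
  assume neg: "\<not> g I a > 0"
  let ?h = "\<lambda>t. Min ((\<lambda>I. g I t) ` F)"
  have F: "finite F" "F \<noteq> {}" using assms by auto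
  have "?h a \<le> g I a" using F \<open>I \<in> F\<close> by (intro Min_le) auto
  then have "?h a \<le> 0" using neg by simp
  moreover have hb: "0 < ?h b" using F end_pos by (subst Min_gr_iff) auto
  ultimately obtain t where t: "a \<le> t" "t \<le> b" "?h t = 0"
    using IVT'[of ?h a 0 b] \<open>a \<le> b\<close> continuous_on_Min[OF F cont] by auto
  have "t < b" using t hb by (cases "t = b") auto
  have nonneg: "g J t \<ge> 0" if "J \<in> F" for J
  proof -
    have "?h t \<le> g J t" using F that by (intro Min_le) auto
    then show ?thesis using t by simp
  qed
  have "0 < ?h t" using F upgrade[OF t(1) \<open>t < b\<close> nonneg] by (subst Min_gr_iff) auto
  then show False using t by simp
qed

text \<open>
  The form in which \<open>nonneg_imp_positive\<close> is applied: \<open>\<sigma>\<close> allows a different sign for each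
  step of the flag.
\<close>

lemma poly_minor_one_sign_imp_positive:
  assumes "\<And>I. I \<subseteq> {..<n} \<Longrightarrow> card I < n \<Longrightarrow> \<sigma> (card I) * poly_minor f I \<ge> 0"
    and "\<And>k. k < n \<Longrightarrow> \<sigma> k * poly_minor f {..<k} \<noteq> 0"
    and "\<And>k. k < n \<Longrightarrow> \<sigma> k * poly_minor f {n - k..<n} \<noteq> 0"
    and "I \<subseteq> {..<n}" "card I < n"
  shows "\<sigma> (card I) * poly_minor f I > 0"
proof (rule nonneg_imp_positive[of 0 n "\<lambda>I. \<sigma> (card I) * poly_minor f I"])
  show "plucker_relations 0 n (\<lambda>I. \<sigma> (card I) * poly_minor f I)"
    unfolding poly_minor_def by (intro plucker_relations_scale plucker_relations_flag_minor)
  show "0 < \<sigma> (card {0..<0 + k}) * poly_minor f {0..<0 + k}" if "k < n - 0" for k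
    using assms(1)[of "{..<k}"] assms(2)[of k] that
    by (simp add: less_le lessThan_subset_iff atLeast0LessThan)
  show "0 < \<sigma> (card {n - k..<n}) * poly_minor f {n - k..<n}" if "k < n - 0" for k
  proof -
    have "{n - k..<n} \<subseteq> {..<n}" by auto
    then show ?thesis using assms(1)[of "{n - k..<n}"] assms(3)[of k] that by (simp add: less_le)
  qed
qed (use assms in \<open>auto simp: atLeast0LessThan\<close>)

text \<open>
  For fixed \<open>b = 1 / d\<close> the parameter starts at \<open>b\<close>, where the normalized minors have the signs
  \<open>s k\<close>, and moves down to \<open>a\<close>. The extremal minors stay nonzero on the way because the
  Wronskians have no zeros on \<open>[a, b]\<close>.
\<close>

lemma moebius_minors_same_sign:
  assumes deg: "\<And>j. degree (f j) \<le> N"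
    and W: "\<And>k x. k \<le> N \<Longrightarrow> x > 0 \<Longrightarrow> poly (wronskian (map f [0..<k])) x \<noteq> 0"
    and "0 < a" "0 < d" "a * d < 1"
    and "k \<le> N" "I \<in> rows_of_size (Suc N) k" "J \<in> rows_of_size (Suc N) k"
  shows "poly_minor (\<lambda>j. moebius N a d (f j)) I * poly_minor (\<lambda>j. moebius N a d (f j)) J > 0"
proof -
  define b where "b = 1 / d"
  have b: "b * d = 1" "a < b" "0 < b" using assms by (auto simp: b_def field_simps)
  let ?\<tau> = "\<lambda>t k. det_fun k (\<lambda>q j. taylor (f j) t q)"
  have \<tau>: "?\<tau> t k \<noteq> 0" if "k \<le> N" "t > 0" for t k
    using W[OF that] by (simp add: poly_wronskian_eq_taylor)
  define s where "s k = endpoint_sign N k * ?\<tau> b k" for k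
  have s: "s k \<noteq> 0" if "k \<le> N" for k
    using that \<tau> b endpoint_sign_nonzero[of k N] by (simp add: s_def)
  let ?F = "{I. I \<subseteq> {..<Suc N} \<and> card I \<le> N}"
  let ?G = "normalized_minor N b d f"
  have pos: "s (card I) * ?G I a > 0" if "I \<in> ?F" for I
  proof (rule positive_along_path[where F = ?F and b = b and a = a and g = "\<lambda>I t. s (card I) * ?G I t"])
    show "continuous_on {a..b} (\<lambda>t. s (card I) * ?G I t)" for I
      unfolding normalized_minor_def by (intro continuous_intros)
    show "s (card I) * ?G I b > 0" if I: "I \<in> ?F" for I
    proof -
      obtain c where c: "c > 0" "endpoint_minor N d I {..<card I} = endpoint_sign N (card I) * c"
        using endpoint_minor_first[of I N "card I" d] I \<open>0 < d\<close> by auto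
      have eq: "s (card I) * ?G I b = c * (s (card I) * s (card I))"
        using I by (simp add: normalized_minor_endpoint c(2) s_def mult_ac)
      have "s (card I) * s (card I) > 0" using s[of "card I"] I by (auto simp: zero_less_mult_iff)
      then show ?thesis unfolding eq using c(1) by (rule mult_pos_pos[rotated])
    qed
    fix t I assume t: "a \<le> t" "t < b" and nonneg: "\<And>J. J \<in> ?F \<Longrightarrow> s (card J) * ?G J t \<ge> 0" and I: "I \<in> ?F"
    define m where "m k = (\<Prod>q<k. (t - b) ^ q)" for k :: nat
    have m: "m k \<noteq> 0" for k using t by (simp add: m_def)
    have eq: "poly_minor (\<lambda>j. moebius N t d (f j)) I = m (card I) * ?G I t" for I
      unfolding m_def by (rule poly_minor_moebius[OF deg b(1)])
    \<comment> \<open>The three-term relations hold for the minors themselves; \<open>m\<close> is the factor between these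
      and the normalized ones, and it is nonzero as long as \<open>t < b\<close>.\<close>
    let ?\<sigma> = "\<lambda>k. s k / m k"
    have "?\<sigma> (card I) * poly_minor (\<lambda>j. moebius N t d (f j)) I > 0"
    proof (rule poly_minor_one_sign_imp_positive[where n = "Suc N"])
      show "?\<sigma> (card I) * poly_minor (\<lambda>j. moebius N t d (f j)) I \<ge> 0"
        if "I \<subseteq> {..<Suc N}" "card I < Suc N" for I
        using nonneg[of I] that m[of "card I"] by (simp add: eq)
      show "?\<sigma> k * poly_minor (\<lambda>j. moebius N t d (f j)) {..<k} \<noteq> 0" if "k < Suc N" for k
      proof -
        have "t * d < b * d" using t \<open>0 < d\<close> by simp
        then have "1 - t * d \<noteq> 0" using b by simp
        then show ?thesis
          using that m[of k] s[of k] \<tau>[of k t] t \<open>0 < a\<close> by (simp add: poly_minor_moebius_first[OF deg])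
      qed
      show "?\<sigma> k * poly_minor (\<lambda>j. moebius N t d (f j)) {Suc N - k..<Suc N} \<noteq> 0" if k: "k < Suc N" for k
      proof -
        obtain c where c: "c > 0" "endpoint_minor N d {Suc N - k..<Suc N} {..<k} = endpoint_sign N k * c"
          using endpoint_minor_first[OF rows_last[of k "Suc N"], of d] k \<open>0 < d\<close> by auto
        have "poly_minor (\<lambda>j. moebius N t d (f j)) {Suc N - k..<Suc N} = c * (m k * s k)"
          using k by (subst poly_minor_moebius_last[OF deg b(1)]) (simp_all add: c(2) m_def s_def mult_ac)
        then show ?thesis using c(1) m[of k] s[of k] k by simp
      qed
    qed (use I in auto)
    then show "s (card I) * ?G I t > 0" using m[of "card I"] by (simp add: eq)
  qed (use that b in auto)
  define m where "m = (\<Prod>q<k. (a - b) ^ q)"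
  have m: "m \<noteq> 0" using b by (simp add: m_def)
  have eq: "poly_minor (\<lambda>j. moebius N a d (f j)) I = m * ?G I a" if "card I = k" for I
    unfolding m_def poly_minor_moebius[OF deg b(1)] that ..
  have "s k * ?G I a > 0" "s k * ?G J a > 0"
    using pos[of I] pos[of J] assms(6-8) by auto
  then have "(s k * ?G I a) * (s k * ?G J a) > 0" by (rule mult_pos_pos)
  then have "(s k * s k) * (?G I a * ?G J a) > 0" by (simp add: mult_ac)
  then have "?G I a * ?G J a > 0" by (simp add: zero_less_mult_iff not_sum_squares_lt_zero)
  moreover have "m * m > 0" using m by (auto simp: zero_less_mult_iff)
  ultimately have "(m * m) * (?G I a * ?G J a) > 0" by (rule mult_pos_pos[rotated])
  then show ?thesis using assms by (simp add: eq mult_ac)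
qed

lemma isCont_det_fun:
  fixes a :: "real \<Rightarrow> nat \<Rightarrow> nat \<Rightarrow> real"
  assumes "\<And>i j. isCont (\<lambda>e. a e i j) x"
  shows "isCont (\<lambda>e. det_fun k (a e)) x"
  unfolding det_fun_Leibniz by (intro continuous_intros assms)

lemma isCont_coeff_moebius: "isCont (\<lambda>e. coeff (moebius N e e f) i) x"
proof -
  have "isCont (\<lambda>e. coeff ([:1, e:] ^ m) l) x" for m l
    unfolding coeff_unit_binomial_power by (intro continuous_intros)
  moreover have "isCont (\<lambda>e. coeff ([:e, 1:] ^ m) l) x" for m l
  proof (cases "l \<le> m")
    case True
    then show ?thesis by (simp add: coeff_linear_poly_power) 
  next
    case False
    have "coeff ([:e, 1:] ^ m) l = 0" for e :: real
    proof (rule coeff_eq_0)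
      have "degree ([:e, 1:] ^ m) \<le> m" by (rule order.trans[OF degree_power_le]) simp
      then show "degree ([:e, 1:] ^ m) < l" using False by simp
    qed
    then show ?thesis by simp
  qed
  ultimately show ?thesis
    unfolding moebius_def coeff_sum coeff_smult coeff_mult by (intro continuous_intros)
qed

lemma moebius_0:
  assumes "degree f \<le> N"
  shows "moebius N 0 0 f = f"
proof -
  have "moebius N 0 0 f = (\<Sum>m\<le>N. monom (coeff f m) m)"
    unfolding moebius_def by (intro sum.cong) (auto simp: monom_altdef one_pCons[symmetric])
  then show ?thesis using poly_as_sum_of_monoms'[OF assms] by simp
qed

text \<open>
  With \<open>a = d = e\<close> the interval \<open>[e, 1 / e]\<close> exhausts \<open>(0, \<infinity>)\<close> as \<open>e\<close> tends to \<open>0\<close>, and the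
  substitution tends to the identity.
\<close>

lemma minors_weakly_same_sign:
  assumes deg: "\<And>j. degree (f j) \<le> N"
    and W: "\<And>k x. k \<le> N \<Longrightarrow> x > 0 \<Longrightarrow> poly (wronskian (map f [0..<k])) x \<noteq> 0"
    and "k \<le> N" "I \<in> rows_of_size (Suc N) k" "J \<in> rows_of_size (Suc N) k"
  shows "poly_minor f I * poly_minor f J \<ge> 0"
proof -
  let ?D = "\<lambda>e I. poly_minor (\<lambda>j. moebius N e e (f j)) I"
  have "isCont (\<lambda>e. ?D e I * ?D e J) 0"
    unfolding poly_minor_def flag_minor_def
    by (intro continuous_intros isCont_det_fun isCont_coeff_moebius)
  then have "((\<lambda>e. ?D e I * ?D e J) \<longlongrightarrow> ?D 0 I * ?D 0 J) (at_right 0)"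
    by (simp add: isCont_def filterlim_at_split)
  moreover have "eventually (\<lambda>e. e \<in> {0<..<1::real}) (at_right 0)"
    by (rule eventually_at_right_real) simp
  then have "eventually (\<lambda>e. 0 \<le> ?D e I * ?D e J) (at_right 0)"
  proof eventually_elim
    case (elim e)
    then have "e * e < 1 * 1" by (intro mult_strict_mono) auto
    then show ?case
      using moebius_minors_same_sign[OF deg W _ _ _ assms(3-5), of e e] elim by simp
  qed
  ultimately have "0 \<le> ?D 0 I * ?D 0 J"
    by (rule tendsto_lowerbound) simp
  then show ?thesis by (simp add: moebius_0[OF deg])
qed

section \<open>Subspaces, bases and Wronskians\<close>

lemma subspace_carrier: "is_subspace n W \<Longrightarrow> w \<in> W \<Longrightarrow> dim_vec w = n"
  by (auto simp: is_subspace_def subspace_def submodule_def module_vec_def)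

lemma mat_of_cols_mult_vec:
  assumes "length bs = k"
  shows "mat_of_cols n bs *\<^sub>v vec k c = vec n (\<lambda>i. \<Sum>j<k. bs ! j $ i * c j)"
  using assms by (intro eq_vecI) (auto simp: scalar_prod_def atLeast0LessThan mat_of_cols_index)

lemma subspace_linear_combination:
  fixes k :: nat
  assumes "is_subspace n W" "\<And>j. j < k \<Longrightarrow> v j \<in> W"
  shows "vec n (\<lambda>i. \<Sum>j<k. v j $ i * c j) \<in> W"
proof -
  interpret vec_space "TYPE(real)" n .
  have sub: "submodule class_ring W V" and W: "W \<subseteq> carrier_vec n"
    using assms(1) by (auto simp: is_subspace_def subspace_def submodule_def)
  let ?bs = "map v [0..<k]"
  have bs: "set ?bs \<subseteq> W" using assms(2) by auto
  have "lincomb_list c ?bs \<in> span_list ?bs" by (auto simp: span_list_def)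
  also have "span_list ?bs = span (set ?bs)" using bs W by (intro span_list_as_span) auto
  also have "\<dots> \<subseteq> W" using bs sub by (rule span_is_subset)
  finally have "lincomb_list c ?bs \<in> W" .
  moreover have "lincomb_list c ?bs = mat_of_cols n ?bs *\<^sub>v vec (length ?bs) c"
  proof (rule lincomb_list_as_mat_mult)
    have "set ?bs \<subseteq> carrier_vec n" using bs W by blast
    then show "\<forall>w\<in>set ?bs. dim_vec w = n" using carrier_vecD by blast
  qed
  moreover have "\<dots> = vec n (\<lambda>i. \<Sum>j<k. v j $ i * c j)"
    by (subst mat_of_cols_mult_vec[OF refl]) (auto intro!: eq_vecI sum.cong)
  ultimately show ?thesis by simp
qed

text \<open>
  Linearly independent subsets of \<open>W\<close> have at most \<open>n\<close> elements, since they are independent in the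
  whole space. So there is a maximal one, and it is a basis.
\<close>

lemma ordered_basis_some_basis:
  assumes "is_subspace n W"
  shows "ordered_basis n W (some_basis n W)"
proof -
  interpret vec_space "TYPE(real)" n .
  have sub: "VectorSpace.subspace class_ring W V" using assms by (simp add: is_subspace_def)
  then have sub': "submodule class_ring W V" "W \<subseteq> carrier_vec n"
    by (auto simp: subspace_def submodule_def)
  interpret W: vectorspace class_ring "vs W" by (rule subspace_is_vs[OF sub])
  have ld: "W.lin_dep S \<longleftrightarrow> lin_dep S" if "S \<subseteq> W" for S
    using span_li_not_depend(2)[OF that sub'(1)] .
  have "\<exists>A. finite A \<and> maximal A (\<lambda>S. S \<subseteq> carrier (vs W) \<and> W.lin_indpt S)"
  proof (rule maximal_exists[where N = n and B = "{}"])
    fix A assume "A \<subseteq> carrier (vs W) \<and> W.lin_indpt A"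
    then have "A \<subseteq> carrier V" "lin_indpt A" using ld[of A] sub'(2) by auto
    then show "finite A \<and> card A \<le> n" using li_le_dim[OF fin_dim] dim_is_n by simp
  next
    show "{} \<subseteq> carrier (vs W) \<and> W.lin_indpt {}" by (auto simp: W.lin_dep_def)
  qed
  then obtain A where "finite A" "W.basis A" using W.max_li_is_basis by blast
  moreover obtain bs where "set bs = A" "distinct bs"
    using finite_distinct_list[OF \<open>finite A\<close>] by blast
  ultimately have "ordered_basis n W bs" by (simp add: ordered_basis_def)
  then show ?thesis unfolding some_basis_def by (rule someI)
qed

lemma
  assumes "is_subspace n W" "ordered_basis n W bs"
  shows length_ordered_basis: "length bs = subspace_dim n W"
    and set_ordered_basis: "set bs \<subseteq> W"
    and ordered_basis_independent:
      "\<And>c j. (\<And>i. i < n \<Longrightarrow> (\<Sum>j<length bs. bs ! j $ i * c j) = 0) \<Longrightarrow> j < length bs \<Longrightarrow> c j = 0"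
    and ordered_basis_spans:
      "\<And>w. w \<in> W \<Longrightarrow> \<exists>c. \<forall>i<n. w $ i = (\<Sum>j<length bs. bs ! j $ i * c j)"
proof -
  interpret vec_space "TYPE(real)" n .
  have sub: "VectorSpace.subspace class_ring W V" using assms by (simp add: is_subspace_def)
  then have sub': "submodule class_ring W V" and W: "W \<subseteq> carrier_vec n"
    by (auto simp: subspace_def submodule_def)
  interpret W: vectorspace class_ring "vs W" by (rule subspace_is_vs[OF sub])
  have bs: "distinct bs" "W.basis (set bs)" using assms(2) by (auto simp: ordered_basis_def)
  then show set: "set bs \<subseteq> W" by (simp add: W.basis_def)
  show "length bs = subspace_dim n W"
    using W.dim_basis[OF _ bs(2)] distinct_card[OF bs(1)] by (simp add: subspace_dim_def)
  have li: "lin_indpt (set bs)" and span: "span (set bs) = W"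
    using bs(2) span_li_not_depend[OF set sub'] by (auto simp: W.basis_def)
  have carr: "set bs \<subseteq> carrier_vec n" using set W by auto
  have lincomb: "lincomb a (set bs) = vec n (\<lambda>i. \<Sum>j<length bs. bs ! j $ i * a (bs ! j))" for a
  proof -
    have "lincomb a (set bs) = lincomb_list (\<lambda>j. a (bs ! j)) bs"
      using carr bs(1) by (rule lincomb_as_lincomb_list_distinct)
    also have "\<dots> = mat_of_cols n bs *\<^sub>v vec (length bs) (\<lambda>j. a (bs ! j))"
      using carr by (intro lincomb_list_as_mat_mult) auto
    finally show ?thesis by (simp only: mat_of_cols_mult_vec)
  qed
  show "c j = 0" if eq: "\<And>i. i < n \<Longrightarrow> (\<Sum>j<length bs. bs ! j $ i * c j) = 0" and j: "j < length bs" for c j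
  proof (rule ccontr)
    assume nz: "c j \<noteq> 0"
    let ?a = "\<lambda>w. c (inv_into {..<length bs} ((!) bs) w)"
    have a: "?a (bs ! i) = c i" if "i < length bs" for i
      using that bs(1) by (subst inv_into_f_f) (auto intro: inj_on_nth)
    have "(\<Sum>j<length bs. bs ! j $ i * ?a (bs ! j)) = (\<Sum>j<length bs. bs ! j $ i * c j)" for i
      by (intro sum.cong refl) (simp only: a lessThan_iff)
    then have "lincomb ?a (set bs) = 0\<^sub>v n"
      unfolding lincomb by (intro eq_vecI) (simp_all add: eq)
    then have "lin_dep (set bs)"
      unfolding lin_dep_def using a[OF j] nz j
      by (intro exI[of _ "set bs"] exI[of _ ?a] exI[of _ "bs ! j"]) auto
    then show False using li by simp
  qed
  show "\<exists>c. \<forall>i<n. w $ i = (\<Sum>j<length bs. bs ! j $ i * c j)" if "w \<in> W" for w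
  proof -
    have "w \<in> span (set bs)" using \<open>w \<in> W\<close> span by simp
    then obtain a where "w = lincomb a (set bs)"
      using finite_span[of "set bs"] carr by auto
    then show ?thesis unfolding lincomb by (intro exI[of _ "\<lambda>j. a (bs ! j)"]) auto
  qed
qed

lemma det_fun_eq_0_imp_kernel:
  fixes a :: "nat \<Rightarrow> nat \<Rightarrow> real"
  assumes "det_fun k a = 0"
  obtains u j where "j < k" "u j \<noteq> 0" "\<And>i. i < k \<Longrightarrow> (\<Sum>j<k. a i j * u j) = 0"
proof -
  let ?A = "mat k k (\<lambda>(i, j). a i j)"
  obtain v where v: "v \<in> carrier_vec k" "v \<noteq> 0\<^sub>v k" "?A *\<^sub>v v = 0\<^sub>v k"
    using assms det_0_iff_vec_prod_zero[of ?A k] by (auto simp: det_fun_def)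
  obtain j where j: "j < k" "v $ j \<noteq> 0" using v(1,2) by (auto simp: vec_eq_iff)
  have "(\<Sum>j<k. a i j * v $ j) = 0" if "i < k" for i
  proof -
    have "(?A *\<^sub>v v) $ i = (\<Sum>j<k. a i j * v $ j)"
      using that v(1) by (auto simp: scalar_prod_def atLeast0LessThan)
    then show ?thesis using that v(3) by simp
  qed
  with j show ?thesis by (rule that)
qed

lemma coeff_poly_of_coeffs: "coeff (poly_of_coeffs v) i = (if i < dim_vec v then v $ i else 0)"
  by (simp add: poly_of_coeffs_def coeff_sum if_distrib cong: if_cong)

lemma degree_poly_of_coeffs: "dim_vec v = Suc N \<Longrightarrow> degree (poly_of_coeffs v) \<le> N"
  by (rule degree_le) (simp add: coeff_poly_of_coeffs)

context
  fixes n k W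
  assumes W: "is_subspace n W" "subspace_dim n W = k"
begin

private definition "bs = some_basis n W"

private lemma bs: "ordered_basis n W bs" "length bs = k"
  using ordered_basis_some_basis[OF W(1)] length_ordered_basis[OF W(1)] W(2) by (auto simp: bs_def)

private lemma bs_dim: "j < k \<Longrightarrow> dim_vec (bs ! j) = n"
  using set_ordered_basis[OF W(1) bs(1)] bs(2) by (intro subspace_carrier[OF W(1)]) auto

lemma plucker_eq_det_fun:
  assumes "I \<in> rows_of_size n k"
  shows "plucker n W I = det_fun k (\<lambda>p j. some_basis n W ! j $ pick I p)"
proof -
  have "{i. i < n \<and> i \<in> I} = I" "{j. j < k} = {..<k}" using assms by auto
  then have "submatrix (mat_of_cols n bs) I UNIV = mat k k (\<lambda>(p, j). bs ! j $ pick I p)"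
    using assms bs(2) pick_less[of I n] unfolding submatrix_def
    by (intro eq_matI) (auto simp: pick_UNIV mat_of_cols_index)
  then show ?thesis by (simp add: plucker_def det_fun_def bs_def)
qed

lemma Wr_expansion:
  "Wr n W = (\<Sum>I\<in>rows_of_size n k. monom (plucker n W I * vandermonde I) (excess I))"
proof -
  have n: "0 < n" if "j < k" for j
    using ordered_basis_independent[OF W(1) bs(1), of "\<lambda>_. 1" j] that bs(2) by (cases n) auto
  have "map poly_of_coeffs bs = map (\<lambda>j. poly_of_coeffs (bs ! j)) [0..<k]"
    using bs(2) by (intro nth_equalityI) auto
  then have "Wr n W = wronskian (map (\<lambda>j. poly_of_coeffs (bs ! j)) [0..<k])"
    by (simp add: Wr_def bs_def)
  also have "\<dots> = (\<Sum>I\<in>rows_of_size n k.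
      monom (flag_minor (\<lambda>i j. coeff (poly_of_coeffs (bs ! j)) i) I * vandermonde I) (excess I))"
  proof (rule wronskian_expansion)
    fix j assume "j < k"
    then have "dim_vec (bs ! j) = Suc (n - 1)" using bs_dim n by simp
    then have "degree (poly_of_coeffs (bs ! j)) \<le> n - 1" by (rule degree_poly_of_coeffs)
    then show "degree (poly_of_coeffs (bs ! j)) < n" using n[OF \<open>j < k\<close>] by simp
  qed
  also have "\<dots> = (\<Sum>I\<in>rows_of_size n k. monom (plucker n W I * vandermonde I) (excess I))"
  proof (rule sum.cong[OF refl])
    fix I assume I: "I \<in> rows_of_size n k"
    have "flag_minor (\<lambda>i j. coeff (poly_of_coeffs (bs ! j)) i) I = det_fun k (\<lambda>p j. bs ! j $ pick I p)"
      using I pick_less[of I n] bs_dim unfolding flag_minor_def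
      by (auto intro!: det_fun_cong simp: coeff_poly_of_coeffs)
    then show "monom (flag_minor (\<lambda>i j. coeff (poly_of_coeffs (bs ! j)) i) I * vandermonde I) (excess I)
        = monom (plucker n W I * vandermonde I) (excess I)"
      by (simp add: plucker_eq_det_fun[OF I] bs_def)
  qed
  finally show ?thesis .
qed

text \<open>
  If all coordinates vanish, then by Cauchy-Binet so does the Gram determinant of the basis. A vector
  \<open>u\<close> in the kernel of the Gram matrix gives a linear combination of the basis with norm zero.
\<close>

lemma exists_nonzero_plucker: "\<exists>I\<in>rows_of_size n k. plucker n W I \<noteq> 0"
proof (rule ccontr)
  assume "\<not> ?thesis"
  then have "det_fun k (\<lambda>p j. bs ! j $ pick I p) = 0" if "I \<in> rows_of_size n k" for I
    using plucker_eq_det_fun[OF that] that by (auto simp: bs_def)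
  then have "det_fun k (\<lambda>i j. \<Sum>m<n. bs ! i $ m * bs ! j $ m) = 0"
    by (subst Cauchy_Binet) (auto intro!: sum.neutral)
  then obtain u j where u: "j < k" "u j \<noteq> 0"
    "\<And>i. i < k \<Longrightarrow> (\<Sum>j<k. (\<Sum>m<n. bs ! i $ m * bs ! j $ m) * u j) = 0"
    by (rule det_fun_eq_0_imp_kernel) blast
  let ?w = "\<lambda>m. \<Sum>j<k. bs ! j $ m * u j"
  have "(\<Sum>m<n. ?w m * ?w m) = (\<Sum>i<k. u i * (\<Sum>j<k. (\<Sum>m<n. bs ! i $ m * bs ! j $ m) * u j))"
    unfolding sum_distrib_left sum_distrib_right
    by (subst sum.swap, rule sum.cong[OF refl], subst sum.swap) (simp add: mult_ac)
  also have "\<dots> = 0" using u(3) by simp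
  finally have "?w m = 0" if "m < n" for m
    using that by (simp add: sum_nonneg_eq_0_iff)
  then show False using ordered_basis_independent[OF W(1) bs(1), of u j] u bs(2) by simp
qed

text \<open>
  All coordinates are multiplied by the determinant of the transition matrix. It is nonzero
  because a vector in the kernel of this matrix would be a linear relation between the \<open>v j\<close>.
\<close>

lemma change_of_basis:
  assumes "\<And>j. j < k \<Longrightarrow> v j \<in> W"
    and "\<And>c j. (\<And>i. i < n \<Longrightarrow> (\<Sum>j<k. v j $ i * c j) = 0) \<Longrightarrow> j < k \<Longrightarrow> c j = 0"
  obtains c where "c \<noteq> 0"
    "\<And>I. I \<in> rows_of_size n k \<Longrightarrow> det_fun k (\<lambda>p j. v j $ pick I p) = c * plucker n W I"
proof -
  have "\<forall>j. \<exists>c. j < k \<longrightarrow> (\<forall>i<n. v j $ i = (\<Sum>l<k. bs ! l $ i * c l))"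
    using ordered_basis_spans[OF W(1) bs(1)] assms(1) bs(2) by metis
  then obtain c where c: "\<And>i j. j < k \<Longrightarrow> i < n \<Longrightarrow> v j $ i = (\<Sum>l<k. bs ! l $ i * c j l)"
    by metis
  show ?thesis
  proof (rule that[of "det_fun k (\<lambda>l j. c j l)"])
    show "det_fun k (\<lambda>l j. c j l) \<noteq> 0"
    proof
      assume "det_fun k (\<lambda>l j. c j l) = 0"
      then obtain u j where u: "j < k" "u j \<noteq> 0" "\<And>l. l < k \<Longrightarrow> (\<Sum>j<k. c j l * u j) = 0"
        by (rule det_fun_eq_0_imp_kernel) blast
      have "(\<Sum>j<k. v j $ i * u j) = 0" if "i < n" for i
      proof -
        have "(\<Sum>j<k. v j $ i * u j) = (\<Sum>j<k. \<Sum>l<k. bs ! l $ i * (c j l * u j))"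
          using c that by (simp add: sum_distrib_right mult.assoc)
        also have "\<dots> = (\<Sum>l<k. bs ! l $ i * (\<Sum>j<k. c j l * u j))"
          unfolding sum_distrib_left by (rule sum.swap)
        finally show ?thesis using u(3) by simp
      qed
      then show False using assms(2)[of u j] u by simp
    qed
    fix I assume I: "I \<in> rows_of_size n k"
    have "det_fun k (\<lambda>p j. v j $ pick I p) = det_fun k (\<lambda>p j. \<Sum>l<k. bs ! l $ pick I p * c j l)"
      using c pick_less[of I n] I by (intro det_fun_cong) auto
    then show "det_fun k (\<lambda>p j. v j $ pick I p) = det_fun k (\<lambda>l j. c j l) * plucker n W I"
      by (simp add: det_fun_mult plucker_eq_det_fun[OF I] bs_def)
  qed
qed

lemma totally_nonneg_imp_Wr_nonzero:
  assumes "totally_nonneg n W" "x > 0"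
  shows "poly (Wr n W) x \<noteq> 0"
proof -
  obtain c where c: "c \<noteq> 0" "\<And>I. I \<in> rows_of_size n k \<Longrightarrow> c * plucker n W I \<ge> 0"
    using assms(1) W(2) by (auto simp: totally_nonneg_def)
  obtain I where I: "I \<in> rows_of_size n k" "plucker n W I \<noteq> 0" using exists_nonzero_plucker by blast
  have "c * poly (Wr n W) x = (\<Sum>I\<in>rows_of_size n k. (c * plucker n W I) * vandermonde I * x ^ excess I)"
    by (simp add: Wr_expansion poly_sum poly_monom sum_distrib_left mult_ac)
  also have "\<dots> > 0"
  proof (rule sum_pos2[OF _ I(1)])
    show "0 < (c * plucker n W I) * vandermonde I * x ^ excess I"
    proof -
      have "c * plucker n W I > 0" using c(1) c(2)[OF I(1)] I(2) by (simp add: less_le)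
      from mult_pos_pos[OF mult_pos_pos[OF this vandermonde_pos] zero_less_power[OF assms(2)]]
      show ?thesis .
    qed
    show "0 \<le> (c * plucker n W J) * vandermonde J * x ^ excess J" if "J \<in> rows_of_size n k" for J
      using c(2)[OF that] vandermonde_pos[of J] assms(2) by simp
  qed (auto intro: finite_subset[of _ "Pow {..<n}"])
  finally show ?thesis by auto
qed

lemma totally_pos_imp_Wr_nonzero:
  assumes "totally_pos n W" "k \<le> n"
  shows "x \<ge> 0 \<Longrightarrow> poly (Wr n W) x \<noteq> 0" and "degree (Wr n W) = k * (n - k)"
proof -
  obtain c where c: "c \<noteq> 0" "\<And>I. I \<in> rows_of_size n k \<Longrightarrow> c * plucker n W I > 0"
    using assms(1) W(2) by (auto simp: totally_pos_def)
  have fin: "finite (rows_of_size n k)" by (auto intro: finite_subset[of _ "Pow {..<n}"])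
  have pos: "c * plucker n W I * vandermonde I > 0" if "I \<in> rows_of_size n k" for I
    using c(2)[OF that] vandermonde_pos by (rule mult_pos_pos)
  show "poly (Wr n W) x \<noteq> 0" if "x \<ge> 0"
  proof -
    have "c * poly (Wr n W) x = (\<Sum>I\<in>rows_of_size n k. (c * plucker n W I * vandermonde I) * x ^ excess I)"
      by (simp add: Wr_expansion poly_sum poly_monom sum_distrib_left mult_ac)
    also have "\<dots> > 0"
    proof (rule sum_pos2[OF fin rows_first[OF assms(2)]])
      show "0 < (c * plucker n W {..<k} * vandermonde {..<k}) * x ^ excess {..<k}"
        using pos[OF rows_first[OF assms(2)]] by (simp add: excess_first)
      show "0 \<le> (c * plucker n W J * vandermonde J) * x ^ excess J" if "J \<in> rows_of_size n k" for J
        using pos[OF that] \<open>x \<ge> 0\<close> by simp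
    qed
    finally show ?thesis by auto
  qed
  have "c * coeff (Wr n W) (k * (n - k)) =
      (\<Sum>I\<in>rows_of_size n k. if excess I = k * (n - k) then c * plucker n W I * vandermonde I else 0)"
    by (auto simp: Wr_expansion coeff_sum sum_distrib_left intro!: sum.cong)
  also have "\<dots> > 0"
  proof (rule sum_pos2[OF fin rows_last[OF assms(2)]])
    show "0 < (if excess {n - k..<n} = k * (n - k) then c * plucker n W {n - k..<n} * vandermonde {n - k..<n} else 0)"
      using pos[OF rows_last[OF assms(2)]] excess_last[OF assms(2)] by simp
  qed (use pos in \<open>auto simp: less_imp_le\<close>)
  finally have "coeff (Wr n W) (k * (n - k)) \<noteq> 0" by auto
  then have "k * (n - k) \<le> degree (Wr n W)" by (rule le_degree)
  moreover have "degree (Wr n W) \<le> k * (n - k)"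
    unfolding Wr_expansion
    by (intro degree_sum_le fin order.trans[OF degree_monom_le] excess_le) simp
  ultimately show "degree (Wr n W) = k * (n - k)" by simp
qed

lemma Wr_nonzero_at_0:
  assumes "poly (Wr n W) 0 \<noteq> 0"
  shows "plucker n W {..<k} \<noteq> 0"
proof
  assume z: "plucker n W {..<k} = 0"
  have "poly (Wr n W) 0 = (\<Sum>I\<in>rows_of_size n k. plucker n W I * vandermonde I * 0 ^ excess I)"
    by (simp add: Wr_expansion poly_sum poly_monom)
  also have "\<dots> = 0"
  proof (intro sum.neutral ballI)
    fix I assume I: "I \<in> rows_of_size n k"
    show "plucker n W I * vandermonde I * 0 ^ excess I = 0"
      using excess_eq_0[OF I] z by (cases "excess I = 0") auto
  qed
  finally show False using assms by simp
qed

lemma Wr_nonzero_at_infinity: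
  assumes "Wr n W \<noteq> 0" "degree (Wr n W) = k * (n - k)"
  shows "plucker n W {n - k..<n} \<noteq> 0"
proof
  assume z: "plucker n W {n - k..<n} = 0"
  have "coeff (Wr n W) (k * (n - k)) = 0"
    unfolding Wr_expansion coeff_sum
  proof (intro sum.neutral ballI)
    fix I assume I: "I \<in> rows_of_size n k"
    show "coeff (monom (plucker n W I * vandermonde I) (excess I)) (k * (n - k)) = 0"
      using excess_eq_max[OF I] z by (cases "excess I = k * (n - k)") auto
  qed
  then show False using assms leading_coeff_0_iff[of "Wr n W"] by simp
qed

end

section \<open>Flags\<close>

lemma complete_flag_mono:
  assumes "complete_flag n V" "1 \<le> i" "i \<le> k" "k \<le> n - 1"
  shows "V i \<subseteq> V k"
  using assms(3,4)
proof (induction k rule: dec_induct)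
  case (step k)
  then have "V k \<subset> V (k + 1)" using assms(1,2) by (auto simp: complete_flag_def)
  then show ?case using step by auto
qed simp

text \<open>
  Choose \<open>v j\<close> in \<open>V (j + 1)\<close> outside \<open>V j\<close>. In a linear relation between \<open>v 0, \<dots>, v k\<close> the last
  coefficient must vanish, since otherwise \<open>v k\<close> would lie in \<open>V k\<close>.
\<close>

lemma flag_adapted_vectors:
  assumes "complete_flag n V"
  obtains v where "\<And>j. dim_vec (v j) = n"
    "\<And>j k. j < k \<Longrightarrow> k \<le> n - 1 \<Longrightarrow> v j \<in> V k"
    "\<And>k c j. k \<le> n - 1 \<Longrightarrow> (\<And>i. i < n \<Longrightarrow> (\<Sum>j<k. v j $ i * c j) = 0) \<Longrightarrow> j < k \<Longrightarrow> c j = 0"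
proof -
  have sub: "is_subspace n (V k)" "subspace_dim n (V k) = k" if "k \<in> {1..n - 1}" for k
    using assms that by (auto simp: complete_flag_def)
  \<comment> \<open>A flag need not have a sensible value at the index \<open>0\<close>, so the zero space is put there.\<close>
  define U where "U j = (if j = 0 then {0\<^sub>v n} else V j)" for j
  have ex: "\<exists>w. w \<in> V (Suc j) \<and> w \<notin> U j" if "j < n - 1" for j
  proof (cases "j = 0")
    case True
    then have s: "is_subspace n (V 1)" "subspace_dim n (V 1) = 1" using sub[of 1] that by auto
    let ?bs = "some_basis n (V 1)"
    note bs = ordered_basis_some_basis[OF s(1)]
    have len: "length ?bs = 1" using length_ordered_basis[OF s(1) bs] s(2) by simp
    then have "?bs ! 0 \<in> V 1" using set_ordered_basis[OF s(1) bs] nth_mem[of 0 ?bs] by auto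
    moreover have "?bs ! 0 \<noteq> 0\<^sub>v n"
    proof
      assume "?bs ! 0 = 0\<^sub>v n"
      then have "(\<Sum>j<length ?bs. ?bs ! j $ i * 1) = 0" if "i < n" for i using that len by simp
      moreover have "0 < length ?bs" using len by simp
      ultimately have "(1 :: real) = 0" by (rule ordered_basis_independent[OF s(1) bs])
      then show False by simp
    qed
    ultimately show ?thesis using True by (auto simp: U_def)
  next
    case False
    then have "V j \<subset> V (j + 1)" using assms that by (auto simp: complete_flag_def)
    then show ?thesis using False by (auto simp: U_def)
  qed
  define v where "v j = (if j < n - 1 then SOME w. w \<in> V (Suc j) \<and> w \<notin> U j else 0\<^sub>v n)" for j
  have v: "v j \<in> V (Suc j)" "v j \<notin> U j" if "j < n - 1" for j
    using someI_ex[OF ex[OF that]] that by (auto simp: v_def)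
  have dim: "dim_vec (v j) = n" for j
  proof (cases "j < n - 1")
    case True
    then show ?thesis using subspace_carrier[OF sub(1) v(1)] by auto
  qed (simp add: v_def)
  have mem: "v j \<in> V k" if "j < k" "k \<le> n - 1" for j k
    using v(1)[of j] complete_flag_mono[OF assms, of "Suc j" k] that by auto
  have indep: "\<forall>j<k. c j = 0" if "k \<le> n - 1" "\<And>i. i < n \<Longrightarrow> (\<Sum>j<k. v j $ i * c j) = 0" for k c
    using that
  proof (induction k)
    case 0
    show ?case by simp
  next
    case (Suc k)
    have "c k = 0"
    proof (rule ccontr)
      assume ck: "c k \<noteq> 0"
      let ?w = "vec n (\<lambda>i. \<Sum>j<k. v j $ i * (- c j / c k))"
      have "v k = ?w"
      proof (rule eq_vecI)
        fix i assume "i < dim_vec ?w"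
        then have "(\<Sum>j<k. v j $ i * c j) + v k $ i * c k = 0" using Suc.prems(2)[of i] by simp
        then have "v k $ i = - (\<Sum>j<k. v j $ i * c j) / c k" using ck by (simp add: field_simps)
        then show "v k $ i = ?w $ i"
          using \<open>i < dim_vec ?w\<close> by (simp add: sum_divide_distrib sum_negf)
      qed (simp add: dim)
      moreover have "?w \<in> U k"
      proof (cases "k = 0")
        case True
        then show ?thesis by (auto simp: U_def)
      next
        case False
        then have "?w \<in> V k"
          using Suc.prems(1) mem sub(1) by (intro subspace_linear_combination) auto
        then show ?thesis using False by (simp add: U_def)
      qed
      ultimately show False using v(2)[of k] Suc.prems(1) by simp
    qed
    have below: "\<forall>j<k. c j = 0"
    proof (rule Suc.IH)
      show "(\<Sum>j<k. v j $ i * c j) = 0" if "i < n" for i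
        using Suc.prems(2)[OF that] \<open>c k = 0\<close> by simp
    qed (use Suc.prems(1) in simp)
    show ?case
    proof (intro allI impI)
      fix j assume "j < Suc k"
      then have "j < k \<or> j = k" by (rule less_SucE) simp_all
      then show "c j = 0" using \<open>c k = 0\<close> below by (elim disjE) simp_all
    qed
  qed
  show ?thesis
  proof (rule that[of v])
    show "dim_vec (v j) = n" for j by (rule dim)
    show "v j \<in> V k" if "j < k" "k \<le> n - 1" for j k using that by (rule mem)
    fix k c j
    assume k: "k \<le> n - 1" and zero: "\<And>i. i < n \<Longrightarrow> (\<Sum>j<k. v j $ i * c j) = 0" and j: "j < k"
    from indep[OF k zero] j show "c j = 0" by blast
  qed
qed

lemma exists_adapted_polys:
  assumes "complete_flag n V" "n = Suc N"
  obtains f d where "\<And>j. degree (f j) \<le> N" "\<And>k. d k \<noteq> 0"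
    "\<And>k I. 1 \<le> k \<Longrightarrow> k \<le> N \<Longrightarrow> I \<in> rows_of_size n k \<Longrightarrow> poly_minor f I = d k * plucker n (V k) I"
    "\<And>k. 1 \<le> k \<Longrightarrow> k \<le> N \<Longrightarrow> wronskian (map f [0..<k]) = Polynomial.smult (d k) (Wr n (V k))"
proof -
  obtain v where v: "\<And>j. dim_vec (v j) = n"
    "\<And>j k. j < k \<Longrightarrow> k \<le> n - 1 \<Longrightarrow> v j \<in> V k"
    "\<And>k c j. k \<le> n - 1 \<Longrightarrow> (\<And>i. i < n \<Longrightarrow> (\<Sum>j<k. v j $ i * c j) = 0) \<Longrightarrow> j < k \<Longrightarrow> c j = 0"
    by (rule flag_adapted_vectors[OF assms(1)]) blast
  have sub: "is_subspace n (V k)" "subspace_dim n (V k) = k" if "1 \<le> k" "k \<le> N" for k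
    using assms that by (auto simp: complete_flag_def)
  define f where "f j = poly_of_coeffs (v j)" for j
  have deg: "degree (f j) \<le> N" for j
    using degree_poly_of_coeffs[of "v j" N] v(1) assms(2) by (simp add: f_def)
  have minor: "poly_minor f I = det_fun k (\<lambda>p j. v j $ pick I p)" if "I \<in> rows_of_size n k" for I k
  proof -
    have I: "card I = k" "I \<subseteq> {..<n}" using that by auto
    show ?thesis
      unfolding poly_minor_def flag_minor_def I(1)
      by (rule det_fun_cong) (use pick_less[OF I(2)] I(1) in \<open>simp add: f_def coeff_poly_of_coeffs v(1)\<close>)
  qed
  have "\<exists>c. c \<noteq> 0 \<and> (1 \<le> k \<longrightarrow> k \<le> N \<longrightarrow> (\<forall>I\<in>rows_of_size n k. poly_minor f I = c * plucker n (V k) I))" for k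
  proof (cases "1 \<le> k \<and> k \<le> N")
    case True
    then have k: "1 \<le> k" "k \<le> N" "k \<le> n - 1" using assms(2) by auto
    obtain c where c: "c \<noteq> 0"
      "\<And>I. I \<in> rows_of_size n k \<Longrightarrow> det_fun k (\<lambda>p j. v j $ pick I p) = c * plucker n (V k) I"
    proof (rule change_of_basis[OF sub[OF k(1,2)], of v])
      show "v j \<in> V k" if "j < k" for j using v(2)[OF that k(3)] .
      show "c j = 0" if zero: "\<And>i. i < n \<Longrightarrow> (\<Sum>j<k. v j $ i * c j) = 0" and j: "j < k" for c j
        using v(3)[OF k(3) zero j] .
    qed blast
    have "\<forall>I\<in>rows_of_size n k. poly_minor f I = c * plucker n (V k) I"
      using minor c(2) by (intro ballI) (simp only:)
    with c(1) show ?thesis by blast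
  next
    case False
    then show ?thesis using zero_neq_one by metis
  qed
  then obtain d where d: "\<And>k. d k \<noteq> 0"
    "\<And>k I. 1 \<le> k \<Longrightarrow> k \<le> N \<Longrightarrow> I \<in> rows_of_size n k \<Longrightarrow> poly_minor f I = d k * plucker n (V k) I"
    by metis
  show ?thesis
  proof (rule that[OF deg d])
    fix k assume k: "1 \<le> k" "k \<le> N"
    have "wronskian (map f [0..<k]) = (\<Sum>I\<in>rows_of_size n k. monom (poly_minor f I * vandermonde I) (excess I))"
      unfolding poly_minor_def using deg assms(2) by (intro wronskian_expansion) (simp add: less_Suc_eq_le)
    also have "\<dots> = (\<Sum>I\<in>rows_of_size n k. Polynomial.smult (d k) (monom (plucker n (V k) I * vandermonde I) (excess I)))"
      by (intro sum.cong refl) (simp add: d(2)[OF k] smult_monom mult.assoc)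
    also have "\<dots> = Polynomial.smult (d k) (Wr n (V k))"
      unfolding Wr_expansion[OF sub[OF k]]
      by (rule poly_eqI) (simp add: coeff_sum sum_distrib_left)
    finally show "wronskian (map f [0..<k]) = Polynomial.smult (d k) (Wr n (V k))" .
  qed
qed

theorem theorem1p1:
  fixes n :: nat and V :: "nat \<Rightarrow> real vec set"
  assumes "complete_flag n V"
  shows "(totally_nonneg_flag n V \<longleftrightarrow>
            (\<forall>k \<in> {1..n - 1}. \<forall>x::real. x > 0 \<longrightarrow> poly (Wr n (V k)) x \<noteq> 0)) \<and>
         (totally_pos_flag n V \<longleftrightarrow>
            (\<forall>k \<in> {1..n - 1}. (\<forall>x::real. x \<ge> 0 \<longrightarrow> poly (Wr n (V k)) x \<noteq> 0) \<and>
               degree (Wr n (V k)) = k * (n - k)))"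
proof (cases n)
  case 0
  then show ?thesis by (simp add: totally_nonneg_flag_def totally_pos_flag_def)
next
  case (Suc N)
  have sub: "is_subspace n (V k)" "subspace_dim n (V k) = k" if "k \<in> {1..n - 1}" for k
    using assms that by (auto simp: complete_flag_def)
  obtain f d where deg: "\<And>j. degree (f j) \<le> N" and d: "\<And>k. d k \<noteq> 0"
    and minor: "\<And>k I. 1 \<le> k \<Longrightarrow> k \<le> N \<Longrightarrow> I \<in> rows_of_size n k \<Longrightarrow> poly_minor f I = d k * plucker n (V k) I"
    and wr: "\<And>k. 1 \<le> k \<Longrightarrow> k \<le> N \<Longrightarrow> wronskian (map f [0..<k]) = Polynomial.smult (d k) (Wr n (V k))"
    by (rule exists_adapted_polys[OF assms Suc]) blast
  have same_sign: "poly_minor f I * poly_minor f J \<ge> 0"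
    if W: "\<forall>k\<in>{1..n - 1}. \<forall>x>0. poly (Wr n (V k)) x \<noteq> 0"
      and IJ: "k \<le> N" "I \<in> rows_of_size n k" "J \<in> rows_of_size n k" for k I J
  proof (rule minors_weakly_same_sign[OF deg])
    show "poly (wronskian (map f [0..<k])) x \<noteq> 0" if "k \<le> N" "x > 0" for k x
    proof (cases "k = 0")
      case True
      then show ?thesis by (simp add: wronskian_def)
    next
      case False
      then show ?thesis using W wr[of k] d[of k] that Suc by auto
    qed
  qed (use IJ Suc in auto)
  have "totally_nonneg n (V k)" if W: "\<forall>k\<in>{1..n - 1}. \<forall>x>0. poly (Wr n (V k)) x \<noteq> 0"
    and k: "k \<in> {1..n - 1}" for k
  proof -
    obtain I where I: "I \<in> rows_of_size n k" "plucker n (V k) I \<noteq> 0"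
      using exists_nonzero_plucker[OF sub[OF k]] by blast
    have "plucker n (V k) I * plucker n (V k) J \<ge> 0" if J: "J \<in> rows_of_size n k" for J
    proof -
      \<comment> \<open>The sign of \<open>d k\<close> is unknown, but it cancels in products of two coordinates.\<close>
      have "(d k * d k) * (plucker n (V k) I * plucker n (V k) J) \<ge> 0"
        using same_sign[OF W _ I(1) J] minor[of k I] minor[of k J] k Suc I J by (simp add: mult_ac)
      moreover have "d k * d k > 0" using d[of k] by (auto simp: zero_less_mult_iff)
      ultimately show ?thesis by (simp only: zero_le_mult_iff) auto
    qed
    then show ?thesis
      unfolding totally_nonneg_def sub(2)[OF k] using I(2) by (intro exI[of _ "plucker n (V k) I"]) auto
  qed
  moreover have "totally_pos n (V k)"
    if W: "\<forall>k\<in>{1..n - 1}. (\<forall>x\<ge>0. poly (Wr n (V k)) x \<noteq> 0) \<and> degree (Wr n (V k)) = k * (n - k)"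
    and k: "k \<in> {1..n - 1}" for k
  proof -
    have empty: "poly_minor f {} = 1" by (simp add: poly_minor_def flag_minor_def det_fun_def)
    have first: "poly_minor f {..<k} \<noteq> 0" if "k < n" for k
    proof (cases "k = 0")
      case False
      then have k: "k \<in> {1..n - 1}" using that by auto
      then have "plucker n (V k) {..<k} \<noteq> 0" using W by (intro Wr_nonzero_at_0[OF sub]) auto
      then show ?thesis using minor[of k "{..<k}"] d[of k] k Suc by simp
    qed (simp add: empty)
    have last: "poly_minor f {n - k..<n} \<noteq> 0" if "k < n" for k
    proof (cases "k = 0")
      case False
      then have k: "k \<in> {1..n - 1}" using that by auto
      then have "poly (Wr n (V k)) 0 \<noteq> 0" using W by auto
      then have "Wr n (V k) \<noteq> 0" by auto
      then have "plucker n (V k) {n - k..<n} \<noteq> 0" using W k by (intro Wr_nonzero_at_infinity[OF sub]) auto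
      moreover have "{n - k..<n} \<in> rows_of_size n k" using that by (intro rows_last) simp
      ultimately show ?thesis using minor[of k "{n - k..<n}"] d[of k] k Suc by simp
    qed (simp add: empty)
    \<comment> \<open>Multiplying by the first extremal coordinate normalizes the common sign of step \<open>k\<close>.\<close>
    let ?\<sigma> = "\<lambda>k. poly_minor f {..<k}"
    have pos: "?\<sigma> (card I) * poly_minor f I > 0" if "I \<subseteq> {..<n}" "card I < n" for I
    proof (rule poly_minor_one_sign_imp_positive[OF _ _ _ that])
      show "?\<sigma> (card I) * poly_minor f I \<ge> 0" if "I \<subseteq> {..<n}" "card I < n" for I
        using W that Suc by (intro same_sign[of "card I"]) auto
    qed (use first last in auto)
    have "?\<sigma> k * d k * plucker n (V k) I > 0" if I: "I \<in> rows_of_size n k" for I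
      using pos[of I] minor[of k I] I k Suc by (simp add: mult.assoc)
    moreover have "?\<sigma> k * d k \<noteq> 0" using first[of k] d[of k] k Suc by auto
    ultimately show ?thesis
      unfolding totally_pos_def sub(2)[OF k] by (intro exI[of _ "?\<sigma> k * d k"]) auto
  qed
  ultimately show ?thesis
    unfolding totally_nonneg_flag_def totally_pos_flag_def
  proof (intro conjI iffI ballI allI impI)
    fix k assume "\<forall>k\<in>{1..n - 1}. totally_pos n (V k)" and k: "k \<in> {1..n - 1}"
    then have "totally_pos n (V k)" "k \<le> n" by auto
    then show "degree (Wr n (V k)) = k * (n - k)" "x \<ge> 0 \<Longrightarrow> poly (Wr n (V k)) x \<noteq> 0" for x
      using totally_pos_imp_Wr_nonzero[OF sub[OF k]] by blast+
  next
    fix k x assume "\<forall>k\<in>{1..n - 1}. totally_nonneg n (V k)" and k: "k \<in> {1..n - 1}" and x: "(x::real) > 0"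
    then have "totally_nonneg n (V k)" by blast
    then show "poly (Wr n (V k)) x \<noteq> 0" using x by (rule totally_nonneg_imp_Wr_nonzero[OF sub[OF k]])
  qed blast+
qed

end
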